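(* If $4 \leq p \leq 5$, then $$\mathscr{C}_p \leq 2\int_{0}^{2/p}\frac{\sin^2\left(\frac{p}{2}\pi x\right)}{\pi^2 x^2}\,dx + 2\sum_{n=0}^{\infty} \int_{n+4/p}^{n+1/2+3/p} \frac{\sin^2\left(\frac{p}{2}\pi(x-n)\right)}{\pi^2x^2}\,dx + 2\sum_{n=0}^{\infty}\int_{n+1/2+3/p}^{n+1+2/p} \frac{\sin^2\left(\frac{p}{2}\pi(x-n-1)\right)}{\pi^2x^2}\,dx.$$
   Context: $PW^p$ denotes the Paley--Wiener space of all functions $f$ in $L^p(\mathbb{R})$ that extend to an entire function of exponential type at most $\pi$. $\mathscr{C}_p$ is the smallest constant $C$ such that $|f(0)|^p\le C\|f\|_p^p$ for every $f\in PW^p$, where $\|f\|_p^p=\int_{\mathbb{R}}|f(x)|^p\,dx$. *)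

theory Defs
  imports "HOL-Complex_Analysis.Complex_Analysis" "HOL-Library.Extended_Real"
begin

definition exponential_type_le :: "real \<Rightarrow> (complex \<Rightarrow> complex) \<Rightarrow> bool" where
  "exponential_type_le \<tau> F \<longleftrightarrow>
     (\<forall>\<epsilon>>0. \<exists>A. \<forall>z. norm (F z) \<le> A * exp ((\<tau> + \<epsilon>) * norm z))"

text \<open>The elements are genuine functions on the line, not classes modulo null sets: each
  class is represented by its unique continuous member, so that \<open>f 0\<close> makes sense.
  Measurability of \<open>f\<close> is automatic, as \<open>f\<close> is the restriction of an entire function.\<close>

definition PW :: "real \<Rightarrow> (real \<Rightarrow> complex) set" where
  "PW p = {f. integrable lborel (\<lambda>x. norm (f x) powr p) \<and>
              (\<exists>F. F holomorphic_on UNIV \<and> exponential_type_le pi F \<and>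
                   (\<forall>x. F (complex_of_real x) = f x))}"

text \<open>The set of admissible constants is closed and, since \<open>PW p\<close> contains a nonzero function
  for \<open>p > 0\<close>, bounded below, so its infimum is its least element whenever it is nonempty.
  The infimum is taken in \<open>ereal\<close> so that the value would be \<open>\<infinity>\<close> if no constant were admissible.\<close>

definition PW_const :: "real \<Rightarrow> ereal" where
  "PW_const p = Inf (ereal ` {C. \<forall>f\<in>PW p.
     norm (f 0) powr p \<le> C * (LINT x|lborel. norm (f x) powr p)})"

end

theory Submission
  imports Defs
begin

text \<open>
  Let \<open>f\<close> be in \<open>PW p\<close>. On the real line \<open>\<bar>f\<bar>\<^sup>2\<close> is the restriction of the entire
  function \<open>F z * cnj (F (cnj z))\<close>, which has exponential type \<open>2 * pi\<close>, so it is reproduced at the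
  origin by the kernel \<open>sin (2 * pi * x) / (pi * x)\<close>. Since \<open>\<bar>f\<bar>\<^sup>2\<close> is nonnegative, the kernel may be
  replaced by its positive part, and Holder's inequality with the exponents \<open>p / 2\<close> and
  \<open>q = p / (p - 2)\<close> gives, with \<open>r = (p - 2) / 2\<close>,
     \<open>\<bar>f 0\<bar> powr p \<le> 2 * N q powr r * \<integral> \<bar>f\<bar> powr p\<close>,
  where \<open>N q\<close> is the integral of the \<open>q\<close>-th power of the positive part of
  \<open>sin (pi * u) / (pi * u)\<close>. This is \<open>PW_const_le\<close>, and it holds for every \<open>p > 2\<close>.

  It remains to compare \<open>2 * N q powr r\<close> with the stated sum of sine integrals. Write \<open>J\<close> for the
  integral of the squared sinc function over \<open>{0..1}\<close> and \<open>T\<close> for its integral over the later intervals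
  \<open>{2..3}, {4..5}, \<dots>\<close> on which sinc is positive, so that \<open>N 2 = 2 * (J + T)\<close>. For \<open>p = 4\<close> all shifts
  in the stated sum are multiples of the period, and the stated sum is exactly \<open>2 * N 2\<close>: both sides agree.
  For larger \<open>p\<close> a change of variables bounds the stated sum below by \<open>p * J + 16 / p * T\<close>
  (\<open>sine_lobe_series_ge\<close>). On the other side \<open>q = 1 + 1 / r\<close> and \<open>ln (N q)\<close> is convex in \<open>q\<close>, so its perspective
  \<open>r * ln (N (1 + 1 / r))\<close> is convex in \<open>r\<close>, and so is \<open>N q powr r\<close>. On \<open>{1..3/2}\<close> it therefore lies below
  the chord that joins its values at \<open>r = 1\<close>, where \<open>q = 2\<close>, and \<open>r = 3/2\<close>, where \<open>q = 5/3\<close>. Both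
  estimates agree at \<open>p = 4\<close>, so only the slopes have to be compared, and this is the numerical inequality
  \<open>4 * N (5/3) powr (3/2) \<le> 10 * J\<close>, roughly 4.4 against 4.5 (\<open>sinc_pos_five_thirds_bound\<close>).

  The reproducing formula is proved by moving the contour to large half circles. This needs a bound by
  \<open>exp (c * \<bar>Im z\<bar>)\<close> with \<open>c\<close> close to the type, which comes from the Phragmen--Lindelof principle. That
  principle asks for control of the function on the line, and integrability of \<open>\<bar>f\<bar> powr p\<close> gives this only
  on average; so it is applied to a primitive, which grows at most linearly on the line, and the bound is carried
  back by Cauchy's estimate.
\<close>

section \<open>The Phragmen--Lindelof principle\<close>

text \<open>
  A quadrant has opening \<open>pi / 2\<close>, so growth of order 1 is below the critical order 2 and a boundary bound
  propagates inside. With \<open>z = w\<^sup>2\<close> the quadrant becomes the sector \<open>0 \<le> Im w \<le> Re w\<close> and the growth becomes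
  \<open>exp (B * \<bar>w\<bar>\<^sup>2)\<close>. A multiplier \<open>exp (- \<epsilon> * L w)\<close> with a cubic polynomial \<open>L\<close> whose real part is positive on
  the sector beats this, and being a polynomial it avoids all branch questions at the corner.
\<close>
lemma phragmen_lindelof_quadrant:
  fixes g :: "complex \<Rightarrow> complex"
  assumes hol: "g holomorphic_on {z. 0 \<le> Re z \<and> 0 \<le> Im z}"
    and growth: "\<And>z. 0 \<le> Re z \<Longrightarrow> 0 \<le> Im z \<Longrightarrow> norm (g z) \<le> A * exp (B * norm z)"
    and boundary: "\<And>z. 0 \<le> Re z \<Longrightarrow> 0 \<le> Im z \<Longrightarrow> Re z = 0 \<or> Im z = 0 \<Longrightarrow> norm (g z) \<le> M"
    and "0 < M" "0 \<le> A" "0 \<le> B" and z: "0 \<le> Re z" "0 \<le> Im z"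
  shows "norm (g z) \<le> M"
proof -
  define \<zeta> where "\<zeta> = csqrt z"
  have \<zeta>2: "\<zeta>\<^sup>2 = z"
    by (simp add: \<zeta>_def)
  have "0 \<le> Im \<zeta> \<and> Im \<zeta> \<le> Re \<zeta>"
  proof -
    have re: "0 \<le> Re \<zeta>"
      using csqrt_principal[of z] by (auto simp: \<zeta>_def)
    have im: "(Re \<zeta>)\<^sup>2 - (Im \<zeta>)\<^sup>2 \<ge> 0" "2 * Re \<zeta> * Im \<zeta> \<ge> 0"
      using z \<zeta>2 Re_power2[of \<zeta>] Im_power2[of \<zeta>] by auto
    have "\<bar>Im \<zeta>\<bar> \<le> Re \<zeta>"
      using im(1) re by (metis abs_le_square_iff abs_of_nonneg diff_ge_0_iff_ge)
    moreover have "0 \<le> Im \<zeta>"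
      using im(2) re \<open>\<bar>Im \<zeta>\<bar> \<le> Re \<zeta>\<close> by (cases "Re \<zeta> = 0") (auto simp: zero_le_mult_iff)
    ultimately show ?thesis by auto
  qed
  then have \<zeta>: "0 \<le> Im \<zeta>" "Im \<zeta> \<le> Re \<zeta>" by auto
  \<comment> \<open>On the sector \<open>w ^ 3\<close> has argument between 0 and \<open>3 * pi / 4\<close>; the factor \<open>1 - 2 * \<i>\<close> turns this range into the right half plane.\<close>
  define L where "L = (\<lambda>w::complex. (1 - 2 * \<i>) * w ^ 3)"
  have ReL: "Re (L w) \<ge> (Re w) ^ 3" if "0 \<le> Im w" "Im w \<le> Re w" for w
  proof -
    have "Re (L w) - (Re w) ^ 3 = 6 * (Re w)^2 * Im w - 3 * Re w * (Im w)^2 - 2 * (Im w)^3"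
      by (simp add: L_def power3_eq_cube power2_eq_square algebra_simps)
    also have "\<dots> = Im w * (3 * Re w * (Re w - Im w) + 2 * (Re w - Im w) * (Re w + Im w) + (Re w)^2)"
      by (simp add: power3_eq_cube power2_eq_square algebra_simps)
    also have "\<dots> \<ge> 0"
      using that by (intro mult_nonneg_nonneg add_nonneg_nonneg) auto
    finally show ?thesis by simp
  qed
  have damped: "norm (g z) \<le> M * exp (\<epsilon> * Re (L \<zeta>))" if "\<epsilon> > 0" for \<epsilon>
  proof -
    have "filterlim (\<lambda>R::real. A * exp (2 * B * R\<^sup>2 - \<epsilon> * R ^ 3)) (nhds 0) at_top"
    proof -
      have "((\<lambda>R::real. exp (2 * B * R\<^sup>2 - \<epsilon> * R ^ 3)) \<longlongrightarrow> 0) at_top"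
      proof (rule filterlim_compose[OF exp_at_bot])
        have "filterlim (\<lambda>R::real. - (2 * B) + \<epsilon> * R) at_top at_top"
          by (intro filterlim_tendsto_add_at_top[OF tendsto_const]
                filterlim_tendsto_pos_mult_at_top[OF tendsto_const] filterlim_ident that)
        then have "filterlim (\<lambda>R::real. R\<^sup>2 * (- (2 * B) + \<epsilon> * R)) at_top at_top"
          by (intro filterlim_at_top_mult_at_top filterlim_pow_at_top filterlim_ident) auto
        then show "filterlim (\<lambda>R::real. 2 * B * R\<^sup>2 - \<epsilon> * R ^ 3) at_bot at_top"
          by (subst filterlim_uminus_at_bot) (simp add: algebra_simps power2_eq_square power3_eq_cube)
      qed
      from tendsto_mult_left[OF this, of A] show ?thesis by simp
    qed
    then have "\<forall>\<^sub>F R in at_top. A * exp (2 * B * R\<^sup>2 - \<epsilon> * R ^ 3) < M \<and> R \<ge> Re \<zeta>"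
      using \<open>0 < M\<close> eventually_conj[OF order_tendstoD(2) eventually_ge_at_top] by blast
    then obtain R where R: "A * exp (2 * B * R\<^sup>2 - \<epsilon> * R ^ 3) < M" "R \<ge> Re \<zeta>"
      by (auto simp: eventually_at_top_linorder)
    define T where "T = {w. 0 \<le> Im w \<and> Im w \<le> Re w \<and> Re w \<le> R}"
    define h where "h = (\<lambda>w. g (w\<^sup>2) * exp (- of_real \<epsilon> * L w))"
    have sq: "0 \<le> Re (w\<^sup>2)" "0 \<le> Im (w\<^sup>2)" if "w \<in> T" for w
      using that power_mono[of "Im w" "Re w" 2] by (auto simp: T_def Re_power2 Im_power2)
    have holh: "h holomorphic_on T"
      unfolding h_def L_def
      by (intro holomorphic_intros holomorphic_on_compose_gen[OF _ hol, unfolded o_def])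
         (use sq in auto)
    have nh: "norm (h w) = norm (g (w\<^sup>2)) * exp (- \<epsilon> * Re (L w))" for w
      by (simp add: h_def norm_mult)
    have "closed T"
      unfolding T_def by (intro closed_Collect_conj closed_Collect_le continuous_intros)
    have "bounded T"
      unfolding bounded_iff
    proof (intro exI ballI)
      fix w assume "w \<in> T"
      then show "norm w \<le> 2 * R"
        using cmod_le[of w] by (auto simp: T_def)
    qed
    have "norm (h \<zeta>) \<le> M"
    proof (rule maximum_modulus_frontier[where f = h and S = T])
      show "h holomorphic_on interior T"
        using holh interior_subset holomorphic_on_subset by blast
      show "continuous_on (closure T) h"
        using holh \<open>closed T\<close> by (simp add: holomorphic_on_imp_continuous_on)
      show "\<zeta> \<in> T"
        using \<zeta> R by (auto simp: T_def)
      fix w assume "w \<in> frontier T"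
      define I where "I = {w. 0 < Im w \<and> Im w < Re w \<and> Re w < R}"
      have "open I"
        unfolding I_def by (intro open_Collect_conj open_Collect_less continuous_intros)
      then have "I \<subseteq> interior T"
        by (intro interior_maximal) (auto simp: I_def T_def)
      then have "w \<in> T" "w \<notin> I"
        using \<open>w \<in> frontier T\<close> \<open>closed T\<close> by (auto simp: frontier_def)
      then consider "Im w = 0 \<or> Im w = Re w" | "Re w = R"
        by (fastforce simp: I_def T_def)
      then show "norm (h w) \<le> M"
      proof cases
        case 1
        then have "norm (g (w\<^sup>2)) \<le> M"
          using sq[OF \<open>w \<in> T\<close>] by (intro boundary) (auto simp: Re_power2 Im_power2)
        moreover have "0 \<le> (Re w) ^ 3" "(Re w) ^ 3 \<le> Re (L w)"
          using \<open>w \<in> T\<close> by (auto simp: T_def intro!: ReL)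
        then have "0 \<le> Re (L w)"
          by (rule order_trans)
        then have "exp (- \<epsilon> * Re (L w)) \<le> 1"
          using \<open>\<epsilon> > 0\<close> by simp
        ultimately show ?thesis
          using mult_mono[of "norm (g (w\<^sup>2))" M "exp (- \<epsilon> * Re (L w))" 1] \<open>0 < M\<close> by (simp add: nh)
      next
        case 2
        have "(norm w)\<^sup>2 \<le> 2 * R\<^sup>2"
          using \<open>w \<in> T\<close> 2 power_mono[of "Im w" "Re w" 2] by (auto simp: T_def cmod_power2)
        then have "B * norm (w\<^sup>2) \<le> 2 * B * R\<^sup>2"
          using mult_left_mono[OF _ \<open>0 \<le> B\<close>] by (fastforce simp: norm_power)
        then have "A * exp (B * norm (w\<^sup>2)) \<le> A * exp (2 * B * R\<^sup>2)"
          using \<open>0 \<le> A\<close> by (intro mult_left_mono) auto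
        then have "norm (g (w\<^sup>2)) \<le> A * exp (2 * B * R\<^sup>2)"
          using growth[OF sq[OF \<open>w \<in> T\<close>]] by linarith
        moreover have "exp (- \<epsilon> * Re (L w)) \<le> exp (- \<epsilon> * R ^ 3)"
          using ReL[of w] \<open>w \<in> T\<close> 2 \<open>\<epsilon> > 0\<close> by (auto simp: T_def)
        ultimately have "norm (h w) \<le> (A * exp (2 * B * R\<^sup>2)) * exp (- \<epsilon> * R ^ 3)"
          unfolding nh using \<open>0 \<le> A\<close> by (intro mult_mono) auto
        also have "\<dots> = A * exp (2 * B * R\<^sup>2 - \<epsilon> * R ^ 3)"
          by (simp add: exp_diff exp_minus field_simps)
        finally show ?thesis using R by simp
      qed
    qed (use \<open>bounded T\<close> in auto)
    then show ?thesis
      by (simp add: nh \<zeta>2 exp_minus field_simps)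
  qed
  have "((\<lambda>\<epsilon>. M * exp (\<epsilon> * Re (L \<zeta>))) \<longlongrightarrow> M * exp (0 * Re (L \<zeta>))) (at_right 0)"
    by (intro tendsto_intros)
  moreover have "\<forall>\<^sub>F \<epsilon> in at_right 0. norm (g z) \<le> M * exp (\<epsilon> * Re (L \<zeta>))"
    using damped by (auto simp: eventually_at_right_less eventually_at intro: exI[of _ 1])
  ultimately show ?thesis
    using tendsto_lowerbound trivial_limit_at_right_real by fastforce
qed

text \<open>
  The factor \<open>exp (\<i> * (\<tau> + \<epsilon>) * z)\<close> removes the growth along the imaginary half axis and has modulus 1 on
  the real one; dividing by \<open>z + 1\<close> absorbs the linear growth there.
\<close>
lemma exponential_type_le_quadrant:
  assumes hol: "f holomorphic_on UNIV" and type: "exponential_type_le \<tau> f" and "0 \<le> \<tau>"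
    and real: "\<And>x::real. norm (f x) \<le> A * (1 + \<bar>x\<bar>)" and "0 < \<epsilon>"
  obtains C where "C > 0"
    "\<And>z. 0 \<le> Re z \<Longrightarrow> 0 \<le> Im z \<Longrightarrow> norm (f z) \<le> C * (1 + norm z) * exp ((\<tau> + \<epsilon>) * \<bar>Im z\<bar>)"
proof -
  obtain K where K: "\<And>z. norm (f z) \<le> K * exp ((\<tau> + \<epsilon>) * norm z)"
    using type \<open>0 < \<epsilon>\<close> unfolding exponential_type_le_def by blast
  have "0 \<le> K * exp ((\<tau> + \<epsilon>) * norm (0::complex))"
    using K[of 0] norm_ge_zero order_trans by blast
  then have "0 \<le> K" by simp
  define c where "c = \<tau> + \<epsilon>"
  have "c > 0" using \<open>0 \<le> \<tau>\<close> \<open>0 < \<epsilon>\<close> by (simp add: c_def)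
  define g where "g = (\<lambda>z. f z * exp (\<i> * c * z) / (z + 1))"
  define M where "M = \<bar>A\<bar> + K + 1"
  have ng: "norm (g z) = norm (f z) * exp (- c * Im z) / norm (z + 1)" for z
    by (simp add: g_def norm_mult norm_divide)
  have ge1: "1 \<le> norm (z + 1)" if "0 \<le> Re z" for z
    using that complex_Re_le_cmod[of "z + 1"] by simp
  have "norm (g z) \<le> M" if z: "0 \<le> Re z" "0 \<le> Im z" for z
  proof (rule phragmen_lindelof_quadrant[where g = g and A = K and B = c])
    show "g holomorphic_on {z. 0 \<le> Re z \<and> 0 \<le> Im z}"
      unfolding g_def
      by (intro holomorphic_intros holomorphic_on_subset[OF hol]) (auto simp: complex_eq_iff)
    show "norm (g z) \<le> K * exp (c * norm z)" if "0 \<le> Re z" "0 \<le> Im z" for z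
    proof -
      have "norm (g z) \<le> norm (f z) * 1 / 1"
        unfolding ng using ge1[OF that(1)] that \<open>c > 0\<close> by (intro frac_le mult_left_mono mult_nonneg_nonneg) auto
      then show ?thesis
        using K[of z] by (simp add: c_def)
    qed
    show "norm (g z) \<le> M" if "0 \<le> Re z" "0 \<le> Im z" "Re z = 0 \<or> Im z = 0" for z
      using that(3)
    proof
      assume "Im z = 0"
      then have z: "z = of_real (Re z)" by (simp add: complex_eq_iff)
      have "norm (z + 1) = 1 + Re z"
        using that(1) by (subst z, subst of_real_1[symmetric], subst of_real_add[symmetric]) simp
      moreover have "norm (f z) \<le> A * (1 + Re z)"
        using real[of "Re z"] that(1) z by simp
      ultimately have "norm (g z) \<le> A"
        unfolding ng using \<open>Im z = 0\<close> that(1) by (simp add: divide_le_eq)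
      then show ?thesis using \<open>0 \<le> K\<close> by (simp add: M_def)
    next
      assume "Re z = 0"
      then have "norm z = Im z"
        using that(2) by (simp add: cmod_def)
      have "norm (g z) \<le> norm (f z) * exp (- c * Im z) / 1"
        unfolding ng using ge1[OF that(1)] by (intro frac_le) auto
      also have "\<dots> \<le> K * exp (c * norm z) * exp (- c * Im z)"
        using K[of z] by (simp add: c_def)
      also have "\<dots> = K"
        using \<open>norm z = Im z\<close> by (simp add: exp_minus)
      finally show ?thesis by (simp add: M_def)
    qed
  qed (use z \<open>0 \<le> K\<close> \<open>c > 0\<close> in \<open>auto simp: M_def\<close>)
  then have "norm (f z) \<le> M * (1 + norm z) * exp ((\<tau> + \<epsilon>) * \<bar>Im z\<bar>)"
    if z: "0 \<le> Re z" "0 \<le> Im z" for z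
  proof -
    have "norm (f z) * exp (- c * Im z) \<le> M * norm (z + 1)"
      using \<open>\<And>z. 0 \<le> Re z \<Longrightarrow> 0 \<le> Im z \<Longrightarrow> norm (g z) \<le> M\<close>[OF z] ge1[OF z(1)]
      by (subst (asm) ng, subst (asm) pos_divide_le_eq) auto
    also have "\<dots> \<le> M * (1 + norm z)"
      using norm_triangle_ineq[of z 1] \<open>0 \<le> K\<close> by (intro mult_left_mono) (auto simp: M_def)
    finally have "norm (f z) * exp (- c * Im z) * exp (c * Im z) \<le> M * (1 + norm z) * exp (c * Im z)"
      by (intro mult_right_mono) auto
    also have "norm (f z) * exp (- c * Im z) * exp (c * Im z) = norm (f z)"
      by (simp add: mult.assoc flip: exp_add)
    finally show ?thesis
      using z by (simp add: c_def)
  qed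
  moreover have "M > 0" using \<open>0 \<le> K\<close> by (simp add: M_def)
  ultimately show ?thesis using that by blast
qed

text \<open>
  The four quadrants are mapped to the first one by \<open>z \<mapsto> - z\<close>, \<open>z \<mapsto> cnj z\<close> and \<open>z \<mapsto> - cnj z\<close>.
\<close>
lemma exponential_type_le_plane:
  assumes hol: "f holomorphic_on UNIV" and type: "exponential_type_le \<tau> f" and "0 \<le> \<tau>"
    and real: "\<And>x::real. norm (f x) \<le> A * (1 + \<bar>x\<bar>)" and "0 < \<epsilon>"
  obtains C where "C > 0"
    "\<And>z. norm (f z) \<le> C * (1 + norm z) * exp ((\<tau> + \<epsilon>) * \<bar>Im z\<bar>)"
proof -
  have hol_cnj: "(\<lambda>z. cnj (g (cnj z))) holomorphic_on UNIV" if "g holomorphic_on UNIV" for g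
  proof -
    have "range cnj = UNIV"
      by (metis complex_cnj_cnj surjI)
    then show ?thesis
      using holomorphic_on_compose_cnj_cnj[of g UNIV] that by (simp add: o_def)
  qed
  have hol_neg: "(\<lambda>z. f (- z)) holomorphic_on UNIV"
    by (intro holomorphic_on_compose_gen[OF _ hol, unfolded o_def] holomorphic_intros) auto
  note Q = exponential_type_le_quadrant[OF _ _ \<open>0 \<le> \<tau>\<close> _ \<open>0 < \<epsilon>\<close>, where A = A]
  obtain C1 where C1: "C1 > 0" "\<And>z. 0 \<le> Re z \<Longrightarrow> 0 \<le> Im z \<Longrightarrow>
      norm (f z) \<le> C1 * (1 + norm z) * exp ((\<tau> + \<epsilon>) * \<bar>Im z\<bar>)"
    using Q[OF hol type real] by blast
  obtain C2 where C2: "C2 > 0" "\<And>z. 0 \<le> Re z \<Longrightarrow> 0 \<le> Im z \<Longrightarrow>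
      norm (f (- z)) \<le> C2 * (1 + norm z) * exp ((\<tau> + \<epsilon>) * \<bar>Im z\<bar>)"
  proof (rule Q[of "\<lambda>z. f (- z)"])
    show "exponential_type_le \<tau> (\<lambda>z. f (- z))"
      using type unfolding exponential_type_le_def by (metis norm_minus_cancel)
    show "norm (f (- of_real x)) \<le> A * (1 + \<bar>x\<bar>)" for x
      using real[of "- x"] by simp
  qed (use hol_neg in auto)
  obtain C3 where C3: "C3 > 0" "\<And>z. 0 \<le> Re z \<Longrightarrow> 0 \<le> Im z \<Longrightarrow>
      norm (cnj (f (cnj z))) \<le> C3 * (1 + norm z) * exp ((\<tau> + \<epsilon>) * \<bar>Im z\<bar>)"
  proof (rule Q[of "\<lambda>z. cnj (f (cnj z))"])
    show "exponential_type_le \<tau> (\<lambda>z. cnj (f (cnj z)))"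
      using type unfolding exponential_type_le_def by (metis complex_mod_cnj)
    show "norm (cnj (f (cnj (of_real x)))) \<le> A * (1 + \<bar>x\<bar>)" for x
      using real[of x] by simp
  qed (use hol_cnj[OF hol] in auto)
  obtain C4 where C4: "C4 > 0" "\<And>z. 0 \<le> Re z \<Longrightarrow> 0 \<le> Im z \<Longrightarrow>
      norm (cnj (f (- cnj z))) \<le> C4 * (1 + norm z) * exp ((\<tau> + \<epsilon>) * \<bar>Im z\<bar>)"
  proof (rule Q[of "\<lambda>z. cnj (f (- cnj z))"])
    show "exponential_type_le \<tau> (\<lambda>z. cnj (f (- cnj z)))"
      using type unfolding exponential_type_le_def by (metis complex_mod_cnj norm_minus_cancel)
    show "norm (cnj (f (- cnj (of_real x)))) \<le> A * (1 + \<bar>x\<bar>)" for x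
      using real[of "- x"] by simp
  qed (use hol_cnj[OF hol_neg] in auto)
  define C where "C = C1 + C2 + C3 + C4"
  have mono: "c * (1 + norm z) * exp ((\<tau> + \<epsilon>) * \<bar>Im z\<bar>) \<le> C * (1 + norm z) * exp ((\<tau> + \<epsilon>) * \<bar>Im z\<bar>)"
    if "c \<le> C" for c z
    using that by (intro mult_right_mono) auto
  have "norm (f z) \<le> C * (1 + norm z) * exp ((\<tau> + \<epsilon>) * \<bar>Im z\<bar>)" for z
  proof -
    consider "0 \<le> Re z" "0 \<le> Im z" | "Re z \<le> 0" "Im z \<le> 0" | "0 \<le> Re z" "Im z \<le> 0" | "Re z \<le> 0" "0 \<le> Im z"
      by linarith
    then show ?thesis
    proof cases
      case 1
      then show ?thesis
        using C2(1) C3(1) C4(1) by (intro order_trans[OF C1(2) mono]) (auto simp: C_def)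
    next
      case 2
      then show ?thesis
        using order_trans[OF C2(2)[of "- z"] mono[of C2]] C1(1) C2(1) C3(1) C4(1) by (simp add: C_def)
    next
      case 3
      then show ?thesis
        using order_trans[OF C3(2)[of "cnj z"] mono[of C3]] C1(1) C2(1) C3(1) C4(1) by (simp add: C_def)
    next
      case 4
      then show ?thesis
        using order_trans[OF C4(2)[of "- cnj z"] mono[of C4]] C1(1) C2(1) C3(1) C4(1) by (simp add: C_def)
    qed
  qed
  moreover have "C > 0" using C1 C2 C3 C4 by (simp add: C_def)
  ultimately show ?thesis using that by blast
qed

section \<open>Growth of entire functions in a Paley--Wiener space\<close>

text \<open>
  Integrating along the segment from the origin costs a factor \<open>\<bar>z\<bar>\<close>, which is dominated by
  \<open>exp (\<epsilon> / 2 * \<bar>z\<bar>)\<close>.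
\<close>
lemma exponential_type_le_primitive:
  assumes der: "\<And>z. (\<Phi> has_field_derivative f z) (at z)" and type: "exponential_type_le \<tau> f" and "0 \<le> \<tau>"
  shows "exponential_type_le \<tau> \<Phi>"
  unfolding exponential_type_le_def
proof (intro allI impI)
  fix \<epsilon> :: real assume "\<epsilon> > 0"
  then obtain K where K: "\<And>z. norm (f z) \<le> K * exp ((\<tau> + \<epsilon> / 2) * norm z)"
    using type unfolding exponential_type_le_def by (meson half_gt_zero)
  have "0 \<le> K * exp ((\<tau> + \<epsilon> / 2) * norm (0::complex))"
    using K[of 0] norm_ge_zero order_trans by blast
  then have "0 \<le> K" by simp
  show "\<exists>A. \<forall>z. norm (\<Phi> z) \<le> A * exp ((\<tau> + \<epsilon>) * norm z)"
  proof (intro exI allI)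
    fix z
    have "norm (\<Phi> z - \<Phi> 0) \<le> (K * exp ((\<tau> + \<epsilon> / 2) * norm z)) * norm (z - 0)"
    proof (rule field_differentiable_bound[where S = "cball 0 (norm z)" and f' = f])
      fix w :: complex assume "w \<in> cball 0 (norm z)"
      then have "exp ((\<tau> + \<epsilon> / 2) * norm w) \<le> exp ((\<tau> + \<epsilon> / 2) * norm z)"
        using \<open>0 \<le> \<tau>\<close> \<open>\<epsilon> > 0\<close> by (simp add: mult_left_mono)
      then show "norm (f w) \<le> K * exp ((\<tau> + \<epsilon> / 2) * norm z)"
        using K[of w] \<open>0 \<le> K\<close> by (meson mult_left_mono order_trans)
    qed (auto intro: der has_field_derivative_at_within)
    also have "\<dots> \<le> (K * exp ((\<tau> + \<epsilon> / 2) * norm z)) * ((2 / \<epsilon>) * exp (\<epsilon> / 2 * norm z))"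
    proof (rule mult_left_mono)
      have "\<epsilon> / 2 * norm z \<le> exp (\<epsilon> / 2 * norm z)"
        using exp_ge_add_one_self[of "\<epsilon> / 2 * norm z"] by linarith
      then show "norm (z - 0) \<le> (2 / \<epsilon>) * exp (\<epsilon> / 2 * norm z)"
        using \<open>\<epsilon> > 0\<close> by (simp add: field_simps)
    qed (use \<open>0 \<le> K\<close> in simp)
    also have "\<dots> = K * (2 / \<epsilon>) * exp ((\<tau> + \<epsilon>) * norm z)"
      by (simp add: mult_exp_exp algebra_simps)
    finally have "norm (\<Phi> z) \<le> norm (\<Phi> 0) * 1 + K * (2 / \<epsilon>) * exp ((\<tau> + \<epsilon>) * norm z)"
      using norm_triangle_ineq2[of "\<Phi> z" "\<Phi> 0"] by linarith
    also have "\<dots> \<le> norm (\<Phi> 0) * exp ((\<tau> + \<epsilon>) * norm z) + K * (2 / \<epsilon>) * exp ((\<tau> + \<epsilon>) * norm z)"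
      using \<open>0 \<le> \<tau>\<close> \<open>\<epsilon> > 0\<close> by (intro add_right_mono mult_left_mono) auto
    also have "\<dots> = (norm (\<Phi> 0) + K * (2 / \<epsilon>)) * exp ((\<tau> + \<epsilon>) * norm z)"
      by (simp add: algebra_simps)
    finally show "norm (\<Phi> z) \<le> (norm (\<Phi> 0) + K * (2 / \<epsilon>)) * exp ((\<tau> + \<epsilon>) * norm z)" .
  qed
qed

text \<open>
  Follows from \<open>t \<le> 1 + t powr p\<close>, applied pointwise to \<open>\<bar>f\<bar>\<close>.
\<close>
lemma integral_linear_growth:
  fixes f :: "real \<Rightarrow> complex"
  assumes cont: "continuous_on UNIV f" and int: "integrable lborel (\<lambda>x. norm (f x) powr p)" and "1 \<le> p"
  shows "norm (LBINT x:{a..b}. f x) \<le> \<bar>b - a\<bar> + (LINT x|lborel. norm (f x) powr p)"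
proof (cases "a \<le> b")
  case True
  have intf: "set_integrable lborel {a..b} f"
    using cont continuous_on_subset by (intro borel_integrable_atLeastAtMost') blast
  have *: "t \<le> 1 + t powr p" if "t \<ge> 0" for t :: real
  proof (cases "t \<le> 1")
    case False
    then have "t powr 1 \<le> t powr p" using \<open>1 \<le> p\<close> by (intro powr_mono) auto
    then show ?thesis using False by simp
  qed (use powr_ge_zero[of t p] in linarith)
  have "norm (LBINT x:{a..b}. f x) \<le> (LBINT x:{a..b}. norm (f x))"
    using set_integral_norm_bound[OF intf] .
  also have "\<dots> \<le> (LINT x|lborel. indicator {a..b} x + norm (f x) powr p)"
    unfolding set_lebesgue_integral_def
  proof (rule integral_mono)
    show "integrable lborel (\<lambda>x. indicat_real {a..b} x *\<^sub>R norm (f x))"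
      using set_integrable_norm[OF intf] by (simp add: set_integrable_def)
    show "integrable lborel (\<lambda>x. indicat_real {a..b} x + norm (f x) powr p)"
      using int by (intro Bochner_Integration.integrable_add integrable_real_indicator) (auto simp: emeasure_lborel_Icc_eq)
    show "indicat_real {a..b} x *\<^sub>R norm (f x) \<le> indicat_real {a..b} x + norm (f x) powr p" for x
      using *[of "norm (f x)"] by (auto split: split_indicator)
  qed
  also have "\<dots> = \<bar>b - a\<bar> + (LINT x|lborel. norm (f x) powr p)"
    using True int by (subst Bochner_Integration.integral_add) auto
  finally show ?thesis .
next
  case False
  then show ?thesis by (simp add: set_lebesgue_integral_def)
qed

text \<open>
  A weak form of the Plancherel--Polya theorem that is enough for contour integration. A primitive \<open>\<Phi>\<close> of \<open>F\<close> has
  the same type as \<open>F\<close> and grows at most linearly on the line, so \<open>exponential_type_le_plane\<close> applies to \<open>\<Phi>\<close>;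
  Cauchy's estimate on unit discs transfers the bound to \<open>F = \<Phi>'\<close>.
\<close>
lemma Lp_exponential_type_growth:
  assumes hol: "F holomorphic_on UNIV" and type: "exponential_type_le \<tau> F" and "0 \<le> \<tau>"
    and int: "integrable lborel (\<lambda>x::real. norm (F x) powr p)" and "1 \<le> p" and "0 < \<epsilon>"
  obtains C where "C > 0" "\<And>z. norm (F z) \<le> C * (1 + norm z) * exp ((\<tau> + \<epsilon>) * \<bar>Im z\<bar>)"
proof -
  obtain \<Phi> where \<Phi>: "\<And>z. (\<Phi> has_field_derivative F z) (at z)"
    using holomorphic_convex_primitive'[OF convex_UNIV open_UNIV hol] by auto
  define I where "I = (LINT x|lborel. norm (F (of_real x)) powr p)"
  have cont: "continuous_on UNIV (\<lambda>x::real. F x)"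
    by (intro continuous_on_compose2[OF holomorphic_on_imp_continuous_on[OF hol]] continuous_intros) auto
  have vd: "((\<lambda>x. \<Phi> (of_real x)) has_vector_derivative F (of_real x)) (at x within S)" for x :: real and S
    using has_vector_derivative_real_field[OF \<Phi>] has_vector_derivative_at_within by blast
  have FTC: "\<Phi> (of_real b) - \<Phi> (of_real a) = (LBINT x:{a..b}. F (of_real x))" if "a \<le> b" for a b :: real
    unfolding set_lebesgue_integral_def
    using that vd cont continuous_on_subset by (subst integral_FTC_atLeastAtMost) blast+
  have "I \<ge> 0" by (simp add: I_def)
  have growth: "norm (\<Phi> (of_real x) - \<Phi> 0) \<le> \<bar>x\<bar> + I" for x :: real
  proof (cases "0 \<le> x")
    case True
    then show ?thesis
      using FTC[of 0 x] integral_linear_growth[OF cont int \<open>1 \<le> p\<close>, of 0 x] by (simp add: I_def)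
  next
    case False
    then show ?thesis
      using FTC[of x 0] integral_linear_growth[OF cont int \<open>1 \<le> p\<close>, of x 0]
      by (simp add: I_def norm_minus_commute)
  qed
  have real: "norm (\<Phi> x) \<le> (1 + I + norm (\<Phi> 0)) * (1 + \<bar>x\<bar>)" for x :: real
  proof -
    have "norm (\<Phi> x) \<le> \<bar>x\<bar> + I + norm (\<Phi> 0)"
      using growth[of x] norm_triangle_ineq2[of "\<Phi> x" "\<Phi> 0"] by linarith
    also have "\<dots> \<le> \<bar>x\<bar> + (I + norm (\<Phi> 0)) * (1 + \<bar>x\<bar>) + 1"
      using \<open>I \<ge> 0\<close> mult_left_mono[of 1 "1 + \<bar>x\<bar>" "I + norm (\<Phi> 0)"] by simp
    finally show ?thesis by (simp add: algebra_simps)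
  qed
  have hol\<Phi>: "\<Phi> holomorphic_on UNIV"
    using \<Phi> by (auto simp: holomorphic_on_open)
  obtain C where C: "C > 0" "\<And>z. norm (\<Phi> z) \<le> C * (1 + norm z) * exp ((\<tau> + \<epsilon>) * \<bar>Im z\<bar>)"
    using exponential_type_le_plane[OF hol\<Phi> exponential_type_le_primitive[OF \<Phi> type \<open>0 \<le> \<tau>\<close>] \<open>0 \<le> \<tau>\<close> real \<open>0 < \<epsilon>\<close>] by blast
  define c where "c = \<tau> + \<epsilon>"
  have "c > 0" using \<open>0 \<le> \<tau>\<close> \<open>0 < \<epsilon>\<close> by (simp add: c_def)
  have "norm (F z) \<le> (2 * C * exp c) * (1 + norm z) * exp ((\<tau> + \<epsilon>) * \<bar>Im z\<bar>)" for z
  proof -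
    have "norm ((deriv ^^ 1) \<Phi> z) \<le> fact 1 * (C * (2 + norm z) * exp (c * (\<bar>Im z\<bar> + 1))) / 1 ^ 1"
    proof (rule Cauchy_inequality)
      show "\<Phi> holomorphic_on ball z 1" "continuous_on (cball z 1) \<Phi>"
        using hol\<Phi> holomorphic_on_subset holomorphic_on_imp_continuous_on by blast+
      fix w assume w: "norm (z - w) = 1"
      have "norm w \<le> norm z + 1"
        using w norm_triangle_sub[of w z] by (simp add: norm_minus_commute)
      moreover have "\<bar>Im w\<bar> \<le> \<bar>Im z\<bar> + 1"
        using w abs_Im_le_cmod[of "z - w"] by simp
      ultimately have "C * (1 + norm w) * exp (c * \<bar>Im w\<bar>) \<le> C * (2 + norm z) * exp (c * (\<bar>Im z\<bar> + 1))"
        using C(1) \<open>c > 0\<close> by (intro mult_mono) auto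
      then show "norm (\<Phi> w) \<le> C * (2 + norm z) * exp (c * (\<bar>Im z\<bar> + 1))"
        using C(2)[of w] by (simp add: c_def)
    qed auto
    moreover have "deriv \<Phi> z = F z"
      using \<Phi> DERIV_imp_deriv by blast
    ultimately have "norm (F z) \<le> C * (2 + norm z) * (exp c * exp (c * \<bar>Im z\<bar>))"
      by (simp add: algebra_simps mult_exp_exp)
    also have "\<dots> \<le> C * (2 * (1 + norm z)) * (exp c * exp (c * \<bar>Im z\<bar>))"
      using C(1) by (intro mult_right_mono mult_left_mono) auto
    also have "\<dots> = (2 * C * exp c) * (1 + norm z) * exp ((\<tau> + \<epsilon>) * \<bar>Im z\<bar>)"
      unfolding c_def by (simp only: mult_ac)
    finally show ?thesis .
  qed
  moreover have "2 * C * exp c > 0" using C(1) by simp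
  ultimately show ?thesis using that by blast
qed

section \<open>The reproducing formula of the sine kernel\<close>

definition entire_sinc :: "complex \<Rightarrow> complex" where
  "entire_sinc w = (if w = 0 then 1 else sin w / w)"

lemma entire_sinc_holomorphic: "entire_sinc holomorphic_on UNIV"
proof -
  have "(\<lambda>z. if z = 0 then deriv sin 0 else (sin z - sin 0) / (z - 0)) holomorphic_on (UNIV :: complex set)"
    by (intro pole_lemma_open holomorphic_intros) auto
  moreover have "deriv sin (0::complex) = 1"
    by (intro DERIV_imp_deriv) (auto intro!: derivative_eq_intros)
  ultimately show ?thesis
    by (simp add: entire_sinc_def[abs_def] cong: if_cong)
qed

lemma norm_entire_sinc_mult_le: "norm (entire_sinc w) * norm w \<le> exp \<bar>Im w\<bar>"
  using cmod_sin_le_exp[of 1 w] by (simp add: entire_sinc_def norm_divide)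

lemma entire_sinc_of_real: "entire_sinc (of_real x) = of_real (if x = 0 then 1 else sin x / x)"
  by (simp add: entire_sinc_def flip: sin_of_real)

lemma abs_sinc_le_1: "\<bar>if x = 0 then 1 else sin x / x\<bar> \<le> (1::real)"
  using abs_sin_x_le_abs_x[of x] by (simp add: abs_divide divide_le_eq)

lemma set_integral_sine_kernel_eq_contour:
  assumes hol: "H holomorphic_on UNIV" and "0 < R"
  shows "(LBINT x:{- R..R}. H (of_real x) * of_real (sin (a * x) / (pi * x)))
    = contour_integral (linepath (- of_real R) (of_real R)) (\<lambda>z. H z * (of_real (a / pi) * entire_sinc (of_real a * z)))"
proof -
  define K where "K = (\<lambda>z. H z * (of_real (a / pi) * entire_sinc (of_real a * z)))"
  have holK: "K holomorphic_on UNIV"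
    unfolding K_def
    by (intro holomorphic_intros hol holomorphic_on_compose_gen[OF _ entire_sinc_holomorphic, unfolded o_def]) auto
  have cont: "continuous_on {- R..R} (\<lambda>x. K (of_real x))"
    by (intro continuous_on_compose2[OF holomorphic_on_imp_continuous_on[OF holK]] continuous_intros) auto
  have "(\<lambda>x. f (complex_of_real x)) \<in> borel_measurable borel" if "f holomorphic_on UNIV" for f
    by (intro borel_measurable_continuous_onI
        continuous_on_compose2[OF holomorphic_on_imp_continuous_on[OF that]] continuous_intros) auto
  note [measurable] = this[OF hol] this[OF holK]
  have "K (of_real x) = H (of_real x) * of_real (sin (a * x) / (pi * x))" if "x \<noteq> 0" for x
  proof -
    have eq: "a / pi * (if a * x = 0 then 1 else sin (a * x) / (a * x)) = sin (a * x) / (pi * x)"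
      using that by (simp add: field_simps)
    have "of_real (a / pi) * entire_sinc (of_real a * of_real x) = of_real (sin (a * x) / (pi * x))"
      by (subst of_real_mult[symmetric], subst entire_sinc_of_real, subst of_real_mult[symmetric]) (simp only: eq)
    then show ?thesis
      by (simp only: K_def)
  qed
  then have "(LBINT x:{- R..R}. H (of_real x) * of_real (sin (a * x) / (pi * x))) = (LBINT x:{- R..R}. K (of_real x))"
    unfolding set_lebesgue_integral_def using AE_lborel_singleton[of 0]
    by (intro integral_cong_AE) auto
  also have "\<dots> = integral {- R..R} (\<lambda>x. K (of_real x))"
    using borel_integrable_atLeastAtMost'[OF cont] by (rule set_borel_integral_eq_integral)
  also have "\<dots> = contour_integral (linepath (- of_real R) (of_real R)) K"
    using contour_integral_linepath_Reals_eq[of "- of_real R" "of_real R" K] \<open>0 < R\<close> by simp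
  finally show ?thesis by (simp add: K_def)
qed

lemma circlepath_split_halves:
  assumes "continuous_on (sphere 0 R) U" "0 < R"
  shows "contour_integral (circlepath 0 R) U =
    contour_integral (part_circlepath 0 R 0 pi) U + contour_integral (part_circlepath 0 R pi (2 * pi)) U"
proof -
  let ?g = "\<lambda>t. U (0 + R * cis t) * R * \<i> * cis t"
  have "continuous_on {0..2 * pi} ?g"
    by (intro continuous_intros continuous_on_compose2[OF assms(1)])
       (use \<open>0 < R\<close> in \<open>auto simp: norm_mult\<close>)
  then have "integral {0..pi} ?g + integral {pi..2 * pi} ?g = integral {0..2 * pi} ?g"
    by (intro Henstock_Kurzweil_Integration.integral_combine integrable_continuous_real) auto
  then show ?thesis
    unfolding circlepath_def
    using contour_integral_part_circlepath_eq[of 0 "2 * pi" 0 R U] contour_integral_part_circlepath_eq[of 0 pi 0 R U]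
      contour_integral_part_circlepath_eq[of pi "2 * pi" 0 R U] by simp
qed

text \<open>
  The integrand is entire, so the segment \<open>{- n..n}\<close> may be replaced by the lower half circle. There the kernel is
  split as \<open>(exp (\<i> * a * z) - exp (- \<i> * a * z)) / (2 * pi * \<i> * z)\<close>. The second exponential is small on the lower
  half circle; the first one is small on the upper half circle, and its integral over the full circle is \<open>H 0\<close> by
  Cauchy's formula.
\<close>
lemma sine_kernel_reproducing:
  assumes hol: "H holomorphic_on UNIV"
    and bd: "\<And>z. 1 \<le> norm z \<Longrightarrow> norm (H z) * norm z \<le> C * exp (a * \<bar>Im z\<bar>)"
  shows "(\<lambda>n. LBINT x:{- real n..real n}. H (of_real x) * of_real (sin (a * x) / (pi * x))) \<longlonglongrightarrow> H 0"
proof -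
  define K where "K = (\<lambda>z. H z * (of_real (a / pi) * entire_sinc (of_real a * z)))"
  define U where "U = (\<lambda>z. H z * exp (\<i> * a * z) / (z - 0) / (2 * of_real pi * \<i>))"
  define V where "V = (\<lambda>z. H z * exp (- (\<i> * a * z)) / (z - 0) / (2 * of_real pi * \<i>))"
  have holK: "K holomorphic_on UNIV"
    unfolding K_def
    by (intro holomorphic_intros hol holomorphic_on_compose_gen[OF _ entire_sinc_holomorphic, unfolded o_def]) auto
  obtain \<Psi> where \<Psi>: "\<And>z. (\<Psi> has_field_derivative K z) (at z)"
    using holomorphic_convex_primitive'[OF convex_UNIV open_UNIV holK] by auto
  have KUV: "K z = U z - V z" if "z \<noteq> 0" for z
    using that by (cases "a = 0") (auto simp: K_def U_def V_def entire_sinc_def sin_exp_eq field_simps)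
  have bound: "norm ((LBINT x:{- real n..real n}. H (of_real x) * of_real (sin (a * x) / (pi * x))) - H 0) \<le> C / real n"
    if "n \<ge> 1" for n :: nat
  proof -
    define R where "R = real n"
    have "R \<ge> 1" using that by (simp add: R_def)
    have "C \<ge> 0"
      using order_trans[OF _ bd[of 1]] by simp
    let ?up = "part_circlepath 0 R 0 pi" and ?low = "part_circlepath 0 R pi (2 * pi)"
    have contU: "continuous_on (sphere 0 R) U" and contV: "continuous_on (sphere 0 R) V"
      unfolding U_def V_def using \<open>R \<ge> 1\<close>
      by (auto intro!: holomorphic_on_imp_continuous_on holomorphic_intros holomorphic_on_subset[OF hol])
    have integrable: "f contour_integrable_on part_circlepath 0 R s t" if "continuous_on (sphere 0 R) f" for f s t
      using that path_image_part_circlepath_subset'[of R 0 s t] \<open>R \<ge> 1\<close>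
      by (intro contour_integrable_continuous_part_circlepath) (auto intro: continuous_on_subset)
    have "(LBINT x:{- R..R}. H (of_real x) * of_real (sin (a * x) / (pi * x))) = contour_integral (linepath (- of_real R) (of_real R)) K"
      unfolding K_def using hol \<open>R \<ge> 1\<close> by (intro set_integral_sine_kernel_eq_contour) auto
    also have "\<dots> = \<Psi> R - \<Psi> (- R)"
      using contour_integral_primitive[of UNIV \<Psi> K "linepath (- of_real R) (of_real R)"] \<Psi> contour_integral_unique by simp
    also have "\<dots> = contour_integral ?low K"
      using contour_integral_primitive[of UNIV \<Psi> K ?low] \<Psi> contour_integral_unique 
        by (simp add: cis_conv_exp[of "2 * pi", simplified])
    also have "\<dots> = contour_integral ?low (\<lambda>z. U z - V z)"
      using in_path_image_part_circlepath[of _ 0 R pi "2 * pi"] \<open>R \<ge> 1\<close>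
      by (intro contour_integral_cong KUV refl) fastforce
    also have "\<dots> = contour_integral ?low U - contour_integral ?low V"
      using integrable contU contV by (intro contour_integral_diff) auto
    also have "contour_integral ?low U = H 0 - contour_integral ?up U"
    proof -
      have "((\<lambda>z. H z * exp (\<i> * a * z) / (z - 0)) has_contour_integral 2 * of_real pi * \<i> * (H 0 * exp (\<i> * a * 0))) (circlepath 0 R)"
        using \<open>R \<ge> 1\<close> by (intro Cauchy_integral_circlepath_simple holomorphic_intros holomorphic_on_subset[OF hol]) auto
      then have "(U has_contour_integral H 0) (circlepath 0 R)"
        unfolding U_def by (auto dest: has_contour_integral_div[where c = "2 * of_real pi * \<i>"])
      then show ?thesis
        using circlepath_split_halves[OF contU] \<open>R \<ge> 1\<close> contour_integral_unique by fastforce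
    qed
    finally have eq: "(LBINT x:{- R..R}. H (of_real x) * of_real (sin (a * x) / (pi * x))) - H 0
      = - contour_integral ?up U - contour_integral ?low V" by simp
    have decay: "norm (H z) * exp (- (a * \<bar>Im z\<bar>)) / R / (2 * pi) \<le> C / R\<^sup>2 / (2 * pi)" if "norm z = R" for z
    proof -
      have "norm (H z) * R * exp (- (a * \<bar>Im z\<bar>)) \<le> C * exp (a * \<bar>Im z\<bar>) * exp (- (a * \<bar>Im z\<bar>))"
        using bd[of z] that \<open>R \<ge> 1\<close> by (intro mult_right_mono) auto
      also have "\<dots> = C"
        by (simp add: mult.assoc flip: exp_add)
      finally show ?thesis
        using \<open>R \<ge> 1\<close> by (simp add: field_simps power2_eq_square)
    qed
    have up: "norm (contour_integral ?up U) \<le> C / R\<^sup>2 / (2 * pi) * R * \<bar>pi - 0\<bar>"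
    proof (rule contour_integral_bound_part_circlepath)
      fix z assume z: "z \<in> path_image ?up"
      then have "norm z = R"
        using in_path_image_part_circlepath[of z 0 R 0 pi] \<open>R \<ge> 1\<close> by simp
      moreover have "Im z \<ge> 0"
        using z \<open>R \<ge> 1\<close> by (auto simp: path_image_part_circlepath' closed_segment_eq_real_ivl sin_ge_zero)
      ultimately show "norm (U z) \<le> C / R\<^sup>2 / (2 * pi)"
        using decay[of z] by (simp add: U_def norm_mult norm_divide)
    qed (use integrable contU \<open>C \<ge> 0\<close> \<open>R \<ge> 1\<close> in auto)
    have low: "norm (contour_integral ?low V) \<le> C / R\<^sup>2 / (2 * pi) * R * \<bar>2 * pi - pi\<bar>"
    proof (rule contour_integral_bound_part_circlepath)
      fix z assume z: "z \<in> path_image ?low"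
      then have "norm z = R"
        using in_path_image_part_circlepath[of z 0 R pi "2 * pi"] \<open>R \<ge> 1\<close> by simp
      moreover have "sin t \<le> 0" if "pi \<le> t" "t \<le> 2 * pi" for t :: real
        using that sin_le_zero[of t] by (cases "t = 2 * pi") auto
      then have "Im z \<le> 0"
        using z \<open>R \<ge> 1\<close> by (auto simp: path_image_part_circlepath' closed_segment_eq_real_ivl mult_le_0_iff)
      ultimately show "norm (V z) \<le> C / R\<^sup>2 / (2 * pi)"
        using decay[of z] by (simp add: V_def norm_mult norm_divide)
    qed (use integrable contV \<open>C \<ge> 0\<close> \<open>R \<ge> 1\<close> in auto)
    have "norm (- contour_integral ?up U - contour_integral ?low V) \<le> C / R\<^sup>2 / (2 * pi) * R * pi + C / R\<^sup>2 / (2 * pi) * R * pi"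
      using up low norm_triangle_ineq4[of "- contour_integral ?up U" "contour_integral ?low V"] by simp
    also have "\<dots> = C / R"
      using \<open>R \<ge> 1\<close> by (simp add: field_simps power2_eq_square)
    finally show ?thesis
      using eq by (simp add: R_def)
  qed
  have "(\<lambda>n. C / real n) \<longlonglongrightarrow> 0"
    by (rule lim_const_over_n)
  moreover have "\<forall>\<^sub>F n in sequentially. norm ((LBINT x:{- real n..real n}. H (of_real x) * of_real (sin (a * x) / (pi * x))) - H 0) \<le> C / real n"
    using bound by (rule eventually_sequentiallyI)
  ultimately have "(\<lambda>n. (LBINT x:{- real n..real n}. H (of_real x) * of_real (sin (a * x) / (pi * x))) - H 0) \<longlonglongrightarrow> 0"
    by (rule Lim_null_comparison[rotated])
  then show ?thesis
    by (rule LIM_zero_cancel)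
qed

section \<open>Point evaluation and the norm of the positive part of sinc\<close>

text \<open>
  The entire extension of \<open>\<bar>f\<bar>\<^sup>2\<close> is multiplied by \<open>entire_sinc (d * z) ^ 4\<close>, which is 1 at the origin, lies in
  \<open>{0..1}\<close> on the line and decays like \<open>\<bar>z\<bar> powr (-4)\<close> up to an exponential in \<open>\<bar>Im z\<bar>\<close>: three powers outweigh the
  polynomial growth of the extension with the decay needed on the half circles, and an even power keeps the sign. The
  price is an increase of the type, hence \<open>a > 2 * pi\<close>. Nonnegativity of \<open>\<bar>f\<bar>\<^sup>2\<close> allows passing to the positive part of the kernel
  and dropping the multiplier.
\<close>
lemma PW_point_value_le_kernel_integral:
  assumes f: "f \<in> PW p" and "1 \<le> p" and a: "2 * pi < a"
    and int: "integrable lborel (\<lambda>x. (norm (f x))\<^sup>2 * max 0 (sin (a * x) / (pi * x)))"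
  shows "(norm (f 0))\<^sup>2 \<le> (LINT x|lborel. (norm (f x))\<^sup>2 * max 0 (sin (a * x) / (pi * x)))"
proof -
  obtain F where hol: "F holomorphic_on UNIV" and type: "exponential_type_le pi F"
    and F: "\<And>x. F (of_real x) = f x" and fp: "integrable lborel (\<lambda>x. norm (f x) powr p)"
    using f by (auto simp: PW_def)
  \<comment> \<open>Two factors of type \<open>pi + d\<close> and four of type \<open>d\<close> have total type \<open>a\<close>.\<close>
  define d where "d = (a - 2 * pi) / 6"
  have "d > 0" using a by (simp add: d_def)
  obtain C where "C > 0" and C: "\<And>z. norm (F z) \<le> C * (1 + norm z) * exp ((pi + d) * \<bar>Im z\<bar>)"
    using Lp_exponential_type_growth[OF hol type _ _ \<open>1 \<le> p\<close> \<open>d > 0\<close>] fp by (auto simp: F)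
  define sc where "sc = (\<lambda>x::real. if d * x = 0 then 1 else sin (d * x) / (d * x))"
  define H where "H = (\<lambda>z. F z * cnj (F (cnj z)) * entire_sinc (of_real d * z) ^ 4)"
  have holH: "H holomorphic_on UNIV"
  proof -
    have "range cnj = UNIV"
      by (metis complex_cnj_cnj surjI)
    then have "(\<lambda>z. cnj (F (cnj z))) holomorphic_on UNIV"
      using holomorphic_on_compose_cnj_cnj[of F UNIV] hol by (simp add: o_def)
    moreover have "(\<lambda>z. entire_sinc (of_real d * z)) holomorphic_on UNIV"
      by (intro holomorphic_on_compose_gen[OF _ entire_sinc_holomorphic, unfolded o_def] holomorphic_intros) auto
    ultimately show ?thesis
      unfolding H_def by (intro holomorphic_intros hol)
  qed
  have bd: "norm (H z) * norm z \<le> (4 * C\<^sup>2 / d ^ 4) * exp (a * \<bar>Im z\<bar>)" if z: "1 \<le> norm z" for z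
  proof -
    define E where "E = exp ((pi + d) * \<bar>Im z\<bar>)"
    define e where "e = exp (d * \<bar>Im z\<bar>)"
    have "norm (F w) \<le> C * (2 * norm z) * E" if "w = z \<or> w = cnj z" for w
    proof -
      have "C * (1 + norm z) * E \<le> C * (2 * norm z) * E"
        using z \<open>C > 0\<close> by (intro mult_right_mono mult_left_mono) (auto simp: E_def)
      then show ?thesis using C[of w] that by (auto simp: E_def)
    qed
    then have "norm (F z) * norm (F (cnj z)) \<le> (C * (2 * norm z) * E) * (C * (2 * norm z) * E)"
      using \<open>C > 0\<close> by (intro mult_mono) (auto simp: E_def)
    moreover have "norm (entire_sinc (of_real d * z)) ^ 4 \<le> (e / (d * norm z)) ^ 4"
    proof (rule power_mono)
      have "0 < d * norm z" using z \<open>d > 0\<close> by (intro mult_pos_pos) auto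
      then show "norm (entire_sinc (of_real d * z)) \<le> e / (d * norm z)"
        using norm_entire_sinc_mult_le[of "of_real d * z"] \<open>d > 0\<close>
        by (simp add: pos_le_divide_eq norm_mult e_def abs_mult)
    qed auto
    ultimately have "norm (H z) \<le> (C * (2 * norm z) * E) * (C * (2 * norm z) * E) * (e / (d * norm z)) ^ 4"
      unfolding H_def norm_mult norm_power complex_mod_cnj
      by (rule mult_mono) (use \<open>C > 0\<close> in \<open>auto simp: E_def\<close>)
    then have "norm (H z) * norm z \<le> (C * (2 * norm z) * E) * (C * (2 * norm z) * E) * (e / (d * norm z)) ^ 4 * norm z"
      by (rule mult_right_mono) simp
    also have "\<dots> = (4 * C\<^sup>2 / d ^ 4) * (E\<^sup>2 * e ^ 4) * (1 / norm z)"
      using z \<open>d > 0\<close> by (simp add: power_divide power_mult_distrib field_simps power2_eq_square eval_nat_numeral)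
    also have "E\<^sup>2 * e ^ 4 = exp (2 * ((pi + d) * \<bar>Im z\<bar>) + 4 * (d * \<bar>Im z\<bar>))"
      by (simp add: E_def e_def exp_add flip: exp_of_nat_mult)
    also have "2 * ((pi + d) * \<bar>Im z\<bar>) + 4 * (d * \<bar>Im z\<bar>) = a * \<bar>Im z\<bar>"
      by (simp add: d_def field_simps)
    also have "(4 * C\<^sup>2 / d ^ 4) * exp (a * \<bar>Im z\<bar>) * (1 / norm z) \<le> (4 * C\<^sup>2 / d ^ 4) * exp (a * \<bar>Im z\<bar>) * 1"
      using z \<open>d > 0\<close> by (intro mult_left_mono) (auto simp: divide_le_eq)
    finally show ?thesis by simp
  qed
  have Hreal: "H (of_real x) = of_real ((norm (f x))\<^sup>2 * sc x ^ 4)" for x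
  proof -
    have "entire_sinc (of_real d * of_real x) = of_real (sc x)"
      unfolding sc_def by (subst of_real_mult[symmetric], subst entire_sinc_of_real) (rule refl)
    moreover have "f x * cnj (f x) = of_real ((norm (f x))\<^sup>2)"
      by (subst complex_norm_square) (rule refl)
    ultimately show ?thesis
      by (simp add: H_def F)
  qed
  have "(\<lambda>n. LBINT x:{- real n..real n}. H (of_real x) * of_real (sin (a * x) / (pi * x))) \<longlonglongrightarrow> H 0"
    by (rule sine_kernel_reproducing[OF holH bd])
  also have "(\<lambda>n. LBINT x:{- real n..real n}. H (of_real x) * of_real (sin (a * x) / (pi * x)))
      = (\<lambda>n. of_real (LBINT x:{- real n..real n}. (norm (f x))\<^sup>2 * sc x ^ 4 * (sin (a * x) / (pi * x))))"
    by (simp only: Hreal set_integral_complex_of_real[symmetric] of_real_mult[symmetric])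
  also have "H 0 = of_real ((norm (f 0))\<^sup>2)"
    using Hreal[of 0] by (simp add: sc_def)
  finally have lim: "(\<lambda>n. LBINT x:{- real n..real n}. (norm (f x))\<^sup>2 * sc x ^ 4 * (sin (a * x) / (pi * x))) \<longlonglongrightarrow> (norm (f 0))\<^sup>2"
    by (simp only: tendsto_of_real_iff)
  have "(LBINT x:{- real n..real n}. (norm (f x))\<^sup>2 * sc x ^ 4 * (sin (a * x) / (pi * x)))
      \<le> (LINT x|lborel. (norm (f x))\<^sup>2 * max 0 (sin (a * x) / (pi * x)))" for n
    unfolding set_lebesgue_integral_def
  proof (rule integral_mono'[OF int])
    fix x
    have "0 \<le> sc x ^ 4" by (simp add: zero_le_even_power)
    have "\<bar>sc x\<bar> ^ 4 \<le> 1 ^ 4"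
      unfolding sc_def by (intro power_mono abs_sinc_le_1) auto
    then have "sc x ^ 4 \<le> 1" by (simp add: power_even_abs)
    have "sc x ^ 4 * (sin (a * x) / (pi * x)) \<le> sc x ^ 4 * max 0 (sin (a * x) / (pi * x))"
      using \<open>0 \<le> sc x ^ 4\<close> by (intro mult_left_mono) auto
    also have "\<dots> \<le> 1 * max 0 (sin (a * x) / (pi * x))"
      using \<open>sc x ^ 4 \<le> 1\<close> by (intro mult_right_mono) auto
    finally have "(norm (f x))\<^sup>2 * (sc x ^ 4 * (sin (a * x) / (pi * x))) \<le> (norm (f x))\<^sup>2 * max 0 (sin (a * x) / (pi * x))"
      by (intro mult_left_mono) auto
    moreover have "0 \<le> (norm (f x))\<^sup>2 * max 0 (sin (a * x) / (pi * x))" by simp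
    ultimately show "indicat_real {- real n..real n} x *\<^sub>R ((norm (f x))\<^sup>2 * sc x ^ 4 * (sin (a * x) / (pi * x)))
        \<le> (norm (f x))\<^sup>2 * max 0 (sin (a * x) / (pi * x))"
      by (simp add: mult.assoc split: split_indicator)
  qed auto
  then show ?thesis
    using lim by (intro LIMSEQ_le_const2) auto
qed

lemma Holder_inequality:
  fixes f g :: "'a \<Rightarrow> real"
  assumes "1 < p" "1 < q" "1 / p + 1 / q = 1"
    and [measurable]: "f \<in> borel_measurable M" "g \<in> borel_measurable M"
    and nn: "\<And>x. 0 \<le> f x" "\<And>x. 0 \<le> g x"
    and f: "integrable M (\<lambda>x. f x powr p)" and g: "integrable M (\<lambda>x. g x powr q)"
  shows "integrable M (\<lambda>x. f x * g x)"
    and "(LINT x|M. f x * g x) \<le> (LINT x|M. f x powr p) powr (1 / p) * (LINT x|M. g x powr q) powr (1 / q)"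
proof -
  have young: "a * b \<le> a powr p / p + b powr q / q" if "0 \<le> a" "0 \<le> b" for a b
    using Youngs_inequality assms that by blast
  show int: "integrable M (\<lambda>x. f x * g x)"
  proof (rule Bochner_Integration.integrable_bound)
    show "integrable M (\<lambda>x. f x powr p / p + g x powr q / q)"
      using f g by auto
    show "AE x in M. norm (f x * g x) \<le> norm (f x powr p / p + g x powr q / q)"
    proof (intro AE_I2)
      fix x
      have "norm (f x * g x) = f x * g x"
        using nn by simp
      also have "\<dots> \<le> f x powr p / p + g x powr q / q"
        using nn by (intro young)
      also have "\<dots> \<le> norm (f x powr p / p + g x powr q / q)"
        unfolding real_norm_def by (rule abs_ge_self)
      finally show "norm (f x * g x) \<le> norm (f x powr p / p + g x powr q / q)" .
    qed
  qed simp
  define A where "A = (LINT x|M. f x powr p)"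
  define B where "B = (LINT x|M. g x powr q)"
  have "A \<ge> 0" "B \<ge> 0" by (auto simp: A_def B_def)
  show "(LINT x|M. f x * g x) \<le> A powr (1 / p) * B powr (1 / q)"
  proof (cases "A = 0 \<or> B = 0")
    case True
    then have "(AE x in M. f x powr p = 0) \<or> (AE x in M. g x powr q = 0)"
      unfolding A_def B_def
      by (subst (asm) (1 2) integral_nonneg_eq_0_iff_AE) (auto simp: f g)
    then have "AE x in M. f x * g x = 0"
      by auto
    then have "(LINT x|M. f x * g x) = 0"
      by (rule integral_eq_zero_AE)
    then show ?thesis by simp
  next
    case False
    then have "A > 0" "B > 0" using \<open>A \<ge> 0\<close> \<open>B \<ge> 0\<close> by auto
    define u where "u = A powr (1 / p)"
    define v where "v = B powr (1 / q)"
    have uv: "u > 0" "v > 0" "u powr p = A" "v powr q = B"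
      using \<open>A > 0\<close> \<open>B > 0\<close> \<open>1 < p\<close> \<open>1 < q\<close> by (auto simp: u_def v_def powr_powr)
    have "(LINT x|M. (f x / u) * (g x / v)) \<le> (LINT x|M. f x powr p / A / p + g x powr q / B / q)"
    proof (rule integral_mono)
      show "integrable M (\<lambda>x. (f x / u) * (g x / v))"
        using int by simp
      show "integrable M (\<lambda>x. f x powr p / A / p + g x powr q / B / q)"
        using f g by auto
      show "(f x / u) * (g x / v) \<le> f x powr p / A / p + g x powr q / B / q" for x
        using young[of "f x / u" "g x / v"] nn uv by (simp add: powr_divide)
    qed
    also have "\<dots> = A / A / p + B / B / q"
      using f g by (simp add: A_def B_def)
    also have "\<dots> = 1"
      using False assms(3) by simp
    finally have "(LINT x|M. f x * g x) / (u * v) \<le> 1"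
      by simp
    then show ?thesis
      using uv by (simp add: u_def v_def divide_le_eq)
  qed
qed

text \<open>
  The positive part of the sinc function. Division by zero makes it vanish at the origin instead of being 1; it is
  used only under integrals, where a single point is irrelevant.
\<close>
definition sinc_pos :: "real \<Rightarrow> real" where
  "sinc_pos u = max 0 (sin (pi * u) / (pi * u))"

lemma sinc_pos_measurable [measurable]: "sinc_pos \<in> borel_measurable borel"
  unfolding sinc_pos_def[abs_def] by measurable

lemma sinc_pos_nonneg: "0 \<le> sinc_pos u"
  by (simp add: sinc_pos_def)

lemma sinc_pos_minus: "sinc_pos (- u) = sinc_pos u"
  by (simp add: sinc_pos_def)

lemma sinc_pos_le_1: "sinc_pos u \<le> 1"
  using abs_le_D1[OF abs_sinc_le_1[of "pi * u"]] by (cases "u = 0") (simp_all add: sinc_pos_def)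

lemma sinc_pos_le_inverse:
  assumes "1 \<le> \<bar>u\<bar>" shows "sinc_pos u \<le> 1 / \<bar>u\<bar>"
proof -
  have "\<bar>sin (pi * u) / (pi * u)\<bar> \<le> 1 / (1 * \<bar>u\<bar>)"
    unfolding abs_divide abs_mult using \<open>1 \<le> \<bar>u\<bar>\<close> pi_ge_two by (intro frac_le mult_right_mono) auto
  from abs_le_D1[OF this] show ?thesis
    by (simp add: sinc_pos_def)
qed

lemma set_integrable_powr_at_infinity:
  assumes "1 < q" shows "set_integrable lborel {1..} (\<lambda>x::real. x powr (- q))"
proof -
  have "((\<lambda>x::real. x powr (- q)) has_integral - (1 powr (- q + 1)) / (- q + 1)) {1..}"
    using \<open>1 < q\<close> by (intro has_integral_powr_to_inf) auto
  then have "(\<lambda>x::real. x powr (- q)) absolutely_integrable_on {1..}"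
    by (intro nonnegative_absolutely_integrable_1) (auto intro: has_integral_integrable)
  then show ?thesis
    unfolding set_integrable_def by (subst (asm) integrable_completion) auto
qed

lemma integrable_sinc_pos_powr:
  assumes "1 < q" shows "integrable lborel (\<lambda>u. sinc_pos u powr q)"
proof (rule Bochner_Integration.integrable_bound)
  have pos: "integrable lborel (\<lambda>x::real. indicator {1..} x * x powr (- q))"
    using set_integrable_powr_at_infinity[OF assms] by (simp add: set_integrable_def)
  have neg: "integrable lborel (\<lambda>x::real. indicator {1..} (- x) * (- x) powr (- q))"
    using lborel_integrable_real_affine[OF pos, of "-1" 0] by simp
  show "integrable lborel (\<lambda>x::real. indicator {-1..1} x
      + (indicator {1..} x * x powr (- q) + indicator {1..} (- x) * (- x) powr (- q)))"
    by (intro Bochner_Integration.integrable_add pos neg integrable_real_indicator) auto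
  have "sinc_pos u powr q \<le> indicator {-1..1} u
      + (indicator {1..} u * u powr (- q) + indicator {1..} (- u) * (- u) powr (- q))" for u
  proof (cases "\<bar>u\<bar> \<le> 1")
    case True
    have "sinc_pos u powr q \<le> 1 powr q"
      using sinc_pos_nonneg sinc_pos_le_1 assms by (intro powr_mono2) auto
    moreover have "0 \<le> indicator {1..} u * u powr (- q) + indicator {1..} (- u) * (- u) powr (- q)"
      by simp
    moreover have "indicat_real {-1..1} u = 1"
      using True by (simp add: abs_le_iff)
    ultimately show ?thesis
      unfolding powr_one_eq_one by linarith
  next
    case False
    have "sinc_pos u powr q \<le> (1 / \<bar>u\<bar>) powr q"
      using False sinc_pos_nonneg sinc_pos_le_inverse[of u] assms by (intro powr_mono2) auto
    also have "\<dots> = \<bar>u\<bar> powr (- q)"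
      using powr_divide[of 1 "\<bar>u\<bar>" q] by (simp add: powr_minus_divide)
    finally show ?thesis using False by (auto simp: indicator_def)
  qed
  then show "AE u in lborel. norm (sinc_pos u powr q) \<le> norm (indicator {-1..1} u
      + (indicator {1..} u * u powr (- q) + indicator {1..} (- u) * (- u) powr (- q)))"
    using sinc_pos_nonneg by (intro AE_I2) (auto intro: order_trans[OF _ abs_ge_self])
qed measurable

lemma sine_kernel_eq_sinc_pos:
  assumes "0 < a"
  shows "max 0 (sin (a * x) / (pi * x)) = a / pi * sinc_pos (a / pi * x)"
  using assms by (simp add: sinc_pos_def max_mult_distrib_left field_simps)

lemma
  assumes "0 < a" "1 < q"
  shows integrable_sine_kernel_powr: "integrable lborel (\<lambda>x. max 0 (sin (a * x) / (pi * x)) powr q)"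
    and integral_sine_kernel_powr: "(LINT x|lborel. max 0 (sin (a * x) / (pi * x)) powr q)
      = (a / pi) powr (q - 1) * (LINT u|lborel. sinc_pos u powr q)"
proof -
  have eq: "max 0 (sin (a * x) / (pi * x)) powr q = (a / pi) powr q * sinc_pos (0 + a / pi * x) powr q" for x
    unfolding sine_kernel_eq_sinc_pos[OF \<open>0 < a\<close>] add_0
    by (rule powr_mult)
  have "integrable lborel (\<lambda>x. sinc_pos (0 + a / pi * x) powr q)"
    using lborel_integrable_real_affine[OF integrable_sinc_pos_powr[OF \<open>1 < q\<close>], of "a / pi" 0] assms by simp
  then show "integrable lborel (\<lambda>x. max 0 (sin (a * x) / (pi * x)) powr q)"
    unfolding eq by simp
  have "(LINT u|lborel. sinc_pos u powr q) = (a / pi) * (LINT x|lborel. sinc_pos (0 + a / pi * x) powr q)"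
    using lborel_integral_real_affine[of "a / pi" "\<lambda>u. sinc_pos u powr q" 0] assms by simp
  then show "(LINT x|lborel. max 0 (sin (a * x) / (pi * x)) powr q)
      = (a / pi) powr (q - 1) * (LINT u|lborel. sinc_pos u powr q)"
    unfolding eq using assms by (simp add: powr_diff)
qed

text \<open>
  Holder's inequality for the kernel with parameter \<open>a > 2 * pi\<close>, followed by \<open>a \<rightarrow> 2 * pi\<close>. Scaling the kernel
  produces the factor \<open>2 powr (q - 1)\<close>, and after raising everything to the power \<open>p / 2\<close> its exponent becomes
  \<open>(q - 1) / q * (p / 2) = 1\<close> for every \<open>p\<close>; hence the factor 2.
\<close>
lemma PW_point_value_le:
  assumes f: "f \<in> PW p" and "2 < p" and q: "q = p / (p - 2)"
  shows "norm (f 0) powr p \<le> 2 * (LINT u|lborel. sinc_pos u powr q) powr ((p - 2) / 2) * (LINT x|lborel. norm (f x) powr p)"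
proof -
  obtain F where hol: "F holomorphic_on UNIV" 
    and F: "\<And>x. F (of_real x) = f x" and fp: "integrable lborel (\<lambda>x. norm (f x) powr p)"
    using f by (auto simp: PW_def)
  define I where "I = (LINT x|lborel. norm (f x) powr p)"
  define N where "N = (LINT u|lborel. sinc_pos u powr q)"
  have "I \<ge> 0" "N \<ge> 0" by (auto simp: I_def N_def)
  have "1 < q" using \<open>2 < p\<close> by (simp add: q divide_simps)
  have conj: "1 / (p / 2) + 1 / q = 1"
    using \<open>2 < p\<close> by (simp add: q field_simps)
  have "continuous_on UNIV (\<lambda>x. F (of_real x))"
    by (intro continuous_on_compose2[OF holomorphic_on_imp_continuous_on[OF hol]] continuous_intros) auto
  then have [measurable]: "f \<in> borel_measurable borel"
    unfolding F by (rule borel_measurable_continuous_onI)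
  have sq: "(norm (f x))\<^sup>2 powr (p / 2) = norm (f x) powr p" for x
    by (cases "norm (f x) = 0") (auto simp: powr_powr simp flip: powr_numeral)
  have ineq: "(norm (f 0))\<^sup>2 \<le> I powr (1 / (p / 2)) * ((a / pi) powr (q - 1) * N) powr (1 / q)" if "a > 2 * pi" for a
  proof -
    have "a > 0" using that pi_gt_zero by linarith
    note H = Holder_inequality[of "p / 2" q "\<lambda>x. (norm (f x))\<^sup>2" lborel "\<lambda>x. max 0 (sin (a * x) / (pi * x))",
        unfolded sq integral_sine_kernel_powr[OF \<open>a > 0\<close> \<open>1 < q\<close>], OF _ \<open>1 < q\<close> conj _ _ _ _ fp integrable_sine_kernel_powr[OF \<open>a > 0\<close> \<open>1 < q\<close>],
        folded I_def N_def]
    have "(norm (f 0))\<^sup>2 \<le> (LINT x|lborel. (norm (f x))\<^sup>2 * max 0 (sin (a * x) / (pi * x)))"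
      using \<open>2 < p\<close> by (intro PW_point_value_le_kernel_integral[OF f _ that] H(1)) auto
    also have "\<dots> \<le> I powr (1 / (p / 2)) * ((a / pi) powr (q - 1) * N) powr (1 / q)"
      using \<open>2 < p\<close> by (intro H(2)) auto
    finally show ?thesis .
  qed
  have "((\<lambda>a. I powr (1 / (p / 2)) * ((a / pi) powr (q - 1) * N) powr (1 / q))
     \<longlongrightarrow> I powr (1 / (p / 2)) * ((2 * pi / pi) powr (q - 1) * N) powr (1 / q)) (at_right (2 * pi))"
  proof (cases "N = 0")
    case False
    have "((\<lambda>a. a / pi) \<longlongrightarrow> 2 * pi / pi) (at_right (2 * pi))"
      by (intro tendsto_intros) simp
    then show ?thesis
      using False by (intro tendsto_mult[OF tendsto_const] tendsto_powr tendsto_mult tendsto_const) auto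
  qed auto
  moreover have "\<forall>\<^sub>F a in at_right (2 * pi). (norm (f 0))\<^sup>2 \<le> I powr (1 / (p / 2)) * ((a / pi) powr (q - 1) * N) powr (1 / q)"
    using ineq by (intro eventually_at_rightI[of _ "2 * pi + 1"]) auto
  ultimately have "(norm (f 0))\<^sup>2 \<le> I powr (1 / (p / 2)) * (2 powr (q - 1) * N) powr (1 / q)"
    using tendsto_lowerbound[OF _ _ trivial_limit_at_right_real] by simp
  then have "((norm (f 0))\<^sup>2) powr (p / 2) \<le> (I powr (1 / (p / 2)) * (2 powr (q - 1) * N) powr (1 / q)) powr (p / 2)"
    using \<open>2 < p\<close> by (intro powr_mono2) auto
  also have "\<dots> = I powr (1 / (p / 2) * (p / 2)) * (2 powr ((q - 1) * (1 / q * (p / 2))) * N powr (1 / q * (p / 2)))"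
    using \<open>I \<ge> 0\<close> \<open>N \<ge> 0\<close> by (simp only: powr_mult powr_powr powr_ge_zero mult_nonneg_nonneg mult.assoc)
  also have "1 / (p / 2) * (p / 2) = 1"
    using \<open>2 < p\<close> by simp
  also have "1 / q * (p / 2) = (p - 2) / 2"
    using \<open>2 < p\<close> by (simp add: q)
  also have "(q - 1) * ((p - 2) / 2) = 1"
    using \<open>2 < p\<close> by (simp add: q field_simps)
  finally show ?thesis
    unfolding sq using \<open>I \<ge> 0\<close> by (simp add: I_def N_def mult_ac)
qed

lemma PW_const_le:
  assumes "2 < p"
  shows "PW_const p \<le> ereal (2 * (LINT u|lborel. sinc_pos u powr (p / (p - 2))) powr ((p - 2) / 2))"
  unfolding PW_const_def using PW_point_value_le[OF _ assms refl] by (intro Inf_lower imageI) auto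

section \<open>Decomposition into lobes\<close>

lemma sinc_pos_eq:
  assumes "2 * real k \<le> u" "u \<le> 2 * real k + 1"
  shows "sinc_pos u = sin (pi * u) / (pi * u)"
proof -
  have "sin (pi * u) = sin (pi * (u - 2 * real k))"
    using sin.plus_of_nat[of "pi * (u - 2 * real k)" k] by (simp add: algebra_simps)
  also have "0 \<le> \<dots>"
    using assms by (intro sin_ge_zero) (auto simp: mult_le_cancel_left1)
  finally have "0 \<le> sin (pi * u) / (pi * u)"
    using assms by (intro divide_nonneg_nonneg) auto
  then show ?thesis by (simp add: sinc_pos_def)
qed

lemma sinc_pos_eq_0:
  assumes "2 * real k + 1 \<le> u" "u \<le> 2 * real k + 2"
  shows "sinc_pos u = 0"
proof -
  have "sin (pi * u) = sin (pi * (u - 2 * real k))"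
    using sin.plus_of_nat[of "pi * (u - 2 * real k)" k] by (simp add: algebra_simps)
  also have "\<dots> = - sin (pi * (u - 2 * real k - 1))"
    using sin_periodic_pi[of "pi * (u - 2 * real k - 1)"] by (simp add: algebra_simps)
  also have "\<dots> \<le> 0"
    using assms by (simp, intro sin_ge_zero) (auto simp: mult_le_cancel_left1)
  finally have "sin (pi * u) / (pi * u) \<le> 0"
    using assms by (intro divide_nonpos_nonneg) auto
  then show ?thesis by (simp add: sinc_pos_def)
qed

text \<open>
  For an even function that vanishes on the intervals \<open>{2 * k + 1..2 * k + 2}\<close>, such as any power of \<open>sinc_pos\<close>, half of
  the integral is made up of the central interval \<open>{0..1}\<close> and the intervals \<open>{2 * k + 2..2 * k + 3}\<close>.
\<close>
lemma integral_even_lobes: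
  fixes h :: "real \<Rightarrow> real"
  assumes h: "integrable lborel h" and even: "\<And>u. h (- u) = h u"
    and gap: "\<And>k u. 2 * real k + 1 \<le> u \<Longrightarrow> u \<le> 2 * real k + 2 \<Longrightarrow> h u = 0"
  shows "(\<lambda>k. LBINT u:{2 * real k + 2..2 * real k + 3}. h u) sums
      ((LINT u|lborel. h u) / 2 - (LBINT u:{0..1}. h u))"
proof -
  have set_int: "set_integrable lborel A h" if "A \<in> sets borel" for A
    unfolding set_integrable_def using that h integrable_mult_indicator by (metis sets_lborel)
  define A where "A = (\<lambda>k::nat. {2 * real k + 2..2 * real k + 3})"
  have disj: "disjoint_family A"
  proof (unfold disjoint_family_on_def, intro ballI impI)
    fix i j :: nat assume "i \<noteq> j"
    then have "i + 1 \<le> j \<or> j + 1 \<le> i" by linarith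
    then have "real i + 1 \<le> real j \<or> real j + 1 \<le> real i" by (metis of_nat_1 of_nat_add of_nat_le_iff)
    then show "A i \<inter> A j = {}" by (auto simp: A_def)
  qed
  have "(\<lambda>n. LBINT u:(\<Union>k<n. A k). h u) \<longlonglongrightarrow> (LBINT u:(\<Union>n. \<Union>k<n. A k). h u)"
  proof (rule set_integral_cont_up)
    show "set_integrable lborel (\<Union>n. \<Union>k<n. A k) h"
      by (intro set_int) (auto simp: A_def)
    show "incseq (\<lambda>n. \<Union>k<n. A k)"
      by (intro incseq_SucI UN_mono) auto
  qed (auto simp: A_def)
  also have "(\<lambda>n. LBINT u:(\<Union>k<n. A k). h u) = (\<lambda>n. \<Sum>k<n. LBINT u:A k. h u)"
    by (intro ext set_integral_finite_Union disjoint_family_on_mono[OF _ disj] set_int) (auto simp: A_def)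
  also have "(\<Union>n. \<Union>k<n. A k) = (\<Union>k. A k)"
    by auto
  finally have sums: "(\<lambda>k. LBINT u:A k. h u) sums (LBINT u:(\<Union>k. A k). h u)"
    by (simp add: sums_def)
  have cover: "h u = indicator {0..1} u * h u + indicator (\<Union>k. A k) u * h u" if "0 \<le> u" for u
  proof -
    have fl: "real (nat \<lfloor>u / 2\<rfloor>) = real_of_int \<lfloor>u / 2\<rfloor>"
      using that by simp
    obtain k where k: "2 * real k \<le> u" "u < 2 * real k + 2"
    proof
      show "2 * real (nat \<lfloor>u / 2\<rfloor>) \<le> u" "u < 2 * real (nat \<lfloor>u / 2\<rfloor>) + 2"
        using floor_correct[of "u / 2"] fl by linarith+
    qed
    show ?thesis
    proof (cases "u \<le> 2 * real k + 1")
      case True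
      show ?thesis
      proof (cases k)
        case 0
        then have "u \<notin> (\<Union>k. A k)" "u \<in> {0..1}" using True that by (auto simp: A_def)
        then show ?thesis by simp
      next
        case (Suc j)
        then have "u \<in> A j" "u \<notin> {0..1}" using True k by (auto simp: A_def)
        then have "u \<in> (\<Union>k. A k)" by blast
        then show ?thesis using \<open>u \<notin> {0..1}\<close> by simp
      qed
    next
      case False
      then show ?thesis using gap[of k u] k by simp
    qed
  qed
  have nonneg: "indicat_real {0..} u * h u = indicat_real {0..1} u * h u + indicat_real (\<Union>k. A k) u * h u" for u
  proof (cases "0 \<le> u")
    case False
    then have "u \<notin> (\<Union>k. A k)" by (auto simp: A_def)
    then show ?thesis using False by simp
  qed (use cover in simp)
  have "(LINT u|lborel. h u) = (LBINT u:{..0}. h u) + (LBINT u:{0..}. h u)"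
  proof -
    have "(LINT u|lborel. h u) = (LINT u|lborel. indicat_real {..0} u * h u + indicat_real {0..} u * h u)"
      using h AE_lborel_singleton[of 0] by (intro integral_cong_AE) (auto simp: indicator_def)
    also have "\<dots> = (LBINT u:{..0}. h u) + (LBINT u:{0..}. h u)"
      using set_int[of "{..0}"] set_int[of "{0..}"]
      by (simp add: set_lebesgue_integral_def set_integrable_def)
    finally show ?thesis .
  qed
  also have "(LBINT u:{..0}. h u) = (LBINT u:{0..}. h u)"
    by (subst set_integral_reflect) (simp add: even atLeast_def)
  also have "(LBINT u:{0..}. h u) = (LBINT u:{0..1}. h u) + (LBINT u:(\<Union>k. A k). h u)"
    unfolding set_lebesgue_integral_def real_scaleR_def nonneg
    using set_int[of "{0..1}"] set_int[of "\<Union>k. A k"]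
    by (subst Bochner_Integration.integral_add) (auto simp: set_integrable_def A_def)
  finally have "(LBINT u:(\<Union>k. A k). h u) = (LINT u|lborel. h u) / 2 - (LBINT u:{0..1}. h u)"
    by linarith
  then show ?thesis
    using sums by (simp add: A_def)
qed

section \<open>Rescaling the sine integrals\<close>

text \<open>
  Unlike \<open>sinc_pos\<close> this is also nonzero on the intervals where sine is negative; it is integrated only over the
  others, where it agrees with \<open>sinc_pos u powr 2\<close>.
\<close>
definition sinc_square :: "real \<Rightarrow> real" where
  "sinc_square u = (sin (pi * u))\<^sup>2 / (pi\<^sup>2 * u\<^sup>2)"

lemma set_integrable_sin_square_over_square:
  assumes "0 < a"
  shows "set_integrable lborel {a..b} (\<lambda>x. (sin (c * (x - d)))\<^sup>2 / (pi\<^sup>2 * x\<^sup>2))"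
  using assms by (intro borel_integrable_atLeastAtMost' continuous_intros) auto

lemma first_integral_rescaled:
  assumes "0 < p"
  shows "(LBINT x:{0..2/p}. (sin (p/2 * pi * x))\<^sup>2 / (pi\<^sup>2 * x\<^sup>2)) = p / 2 * (LBINT u:{0..1}. sinc_square u)"
proof -
  have "(LBINT x:{0..2/p}. (sin (p/2 * pi * x))\<^sup>2 / (pi\<^sup>2 * x\<^sup>2))
     = 2/p * (LINT u|lborel. indicator {0..2/p} (0 + 2/p * u) *\<^sub>R ((sin (p/2 * pi * (0 + 2/p * u)))\<^sup>2 / (pi\<^sup>2 * (0 + 2/p * u)\<^sup>2)))"
    unfolding set_lebesgue_integral_def
    using assms by (subst lborel_integral_real_affine[where c = "2/p" and t = 0]) auto
  also have "(\<lambda>u. indicator {0..2/p} (0 + 2/p * u) *\<^sub>R ((sin (p/2 * pi * (0 + 2/p * u)))\<^sup>2 / (pi\<^sup>2 * (0 + 2/p * u)\<^sup>2)))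
     = (\<lambda>u. (p/2)\<^sup>2 * (indicator {0..1} u *\<^sub>R sinc_square u))"
    using assms by (auto simp: fun_eq_iff indicator_def field_simps power_mult_distrib power_divide sinc_square_def)
  also have "2/p * (LINT u|lborel. (p/2)\<^sup>2 * (indicator {0..1} u *\<^sub>R sinc_square u)) = 2/p * (p/2)\<^sup>2 * (LBINT u:{0..1}. sinc_square u)"
    by (simp add: set_lebesgue_integral_def)
  also have "2/p * (p/2)\<^sup>2 = p/2"
    using assms by (simp add: power2_eq_square)
  finally show ?thesis .
qed

text \<open>
  The substitution \<open>x = m + 2 / p * (u - 2 * m)\<close> turns the shifted phase into \<open>pi * u\<close> up to a multiple of the period.
  For \<open>p \<ge> 4\<close> it satisfies \<open>x \<le> u / 2\<close>, so that \<open>1 / x\<^sup>2 \<ge> 4 / u\<^sup>2\<close>; together with \<open>dx = 2 / p * du\<close> this is the factor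
  \<open>8 / p\<close>.
\<close>
lemma lobe_integral_ge:
  fixes m :: nat
  assumes "4 \<le> p" "0 < a" "0 < \<alpha>"
    and sub: "\<And>u. \<alpha> \<le> u \<Longrightarrow> u \<le> \<beta> \<Longrightarrow> real m + 2 / p * (u - 2 * real m) \<in> {a..b}"
    and le: "\<And>u. \<alpha> \<le> u \<Longrightarrow> u \<le> \<beta> \<Longrightarrow> 2 * real m \<le> u"
  shows "8 / p * (LBINT u:{\<alpha>..\<beta>}. sinc_square u)
    \<le> (LBINT x:{a..b}. (sin (p/2 * pi * (x - real m)))\<^sup>2 / (pi\<^sup>2 * x\<^sup>2))"
proof -
  define t where "t = real m - 2/p * (2 * real m)"
  define g where "g = (\<lambda>x. indicator {a..b} x *\<^sub>R ((sin (p/2 * pi * (x - real m)))\<^sup>2 / (pi\<^sup>2 * x\<^sup>2)))"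
  have "0 < p" using assms by simp
  have g: "integrable lborel g"
    using set_integrable_sin_square_over_square[OF \<open>0 < a\<close>, of b "p/2 * pi" "real m"] by (simp add: g_def set_integrable_def)
  have aff: "integrable lborel (\<lambda>u. g (t + 2/p * u))"
    using \<open>0 < p\<close> by (intro lborel_integrable_real_affine[OF g]) auto
  have "4 * (LBINT u:{\<alpha>..\<beta>}. sinc_square u) = (LINT u|lborel. 4 * (indicator {\<alpha>..\<beta>} u *\<^sub>R sinc_square u))"
    by (simp add: set_lebesgue_integral_def)
  also have "\<dots> \<le> (LINT u|lborel. g (t + 2/p * u))"
  proof (rule integral_mono'[OF aff])
    fix u :: real
    show "0 \<le> g (t + 2/p * u)" by (simp add: g_def)
    show "4 * (indicator {\<alpha>..\<beta>} u *\<^sub>R sinc_square u) \<le> g (t + 2/p * u)"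
    proof (cases "u \<in> {\<alpha>..\<beta>}")
      case True
      define x where "x = t + 2/p * u"
      have x: "x = real m + 2 / p * (u - 2 * real m)"
        by (simp add: x_def t_def right_diff_distrib)
      then have "x \<in> {a..b}" using sub[of u] True by simp
      have phase: "p/2 * pi * (x - real m) = pi * (u - 2 * real m)"
        using \<open>0 < p\<close> by (simp add: x)
      have "sin (p/2 * pi * (x - real m)) = sin (pi * u)"
      proof -
        have "pi * u = pi * (u - 2 * real m) + real m * (2 * pi)"
          by (simp add: algebra_simps)
        then show ?thesis
          unfolding phase using sin.plus_of_nat[of "pi * (u - 2 * real m)" m] by simp
      qed
      then have gx: "g x = (sin (pi * u))\<^sup>2 / (pi\<^sup>2 * x\<^sup>2)"
        using \<open>x \<in> {a..b}\<close> by (simp add: g_def)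
      have "2 / p * (u - 2 * real m) \<le> 1 / 2 * (u - 2 * real m)"
        using le[of u] True \<open>4 \<le> p\<close> by (intro mult_right_mono) (auto simp: field_simps)
      then have "x \<le> u / 2"
        by (simp add: x)
      then have "x\<^sup>2 \<le> (u / 2)\<^sup>2"
        using \<open>x \<in> {a..b}\<close> \<open>0 < a\<close> by (intro power_mono) auto
      then have "(sin (pi * u))\<^sup>2 / (pi\<^sup>2 * (u / 2)\<^sup>2) \<le> g x"
        unfolding gx using \<open>x \<in> {a..b}\<close> \<open>0 < a\<close> \<open>x \<le> u / 2\<close> by (intro divide_left_mono mult_left_mono mult_pos_pos) auto
      moreover have "(sin (pi * u))\<^sup>2 / (pi\<^sup>2 * (u / 2)\<^sup>2) = 4 * sinc_square u"
        by (simp add: sinc_square_def power_divide)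
      ultimately show ?thesis
        using True by (simp only: x_def indicator_simps(1) scaleR_one)
    qed (simp add: g_def)
  qed
  finally have "2/p * (4 * (LBINT u:{\<alpha>..\<beta>}. sinc_square u)) \<le> 2/p * (LINT u|lborel. g (t + 2/p * u))"
    using \<open>0 < p\<close> by (intro mult_left_mono) auto
  also have "\<dots> = (LINT x|lborel. g x)"
    using \<open>0 < p\<close> lborel_integral_real_affine[of "2/p" g t] by simp
  finally show ?thesis by (simp add: g_def set_lebesgue_integral_def)
qed

text \<open>
  Provides the summability of both series of sine integrals by comparison with inverse squares.
\<close>
lemma lobe_integral_bounds:
  assumes "4 * (real n + 1) \<le> 5 * a" "b \<le> a + 1"
  shows "0 \<le> (LBINT x:{a..b}. (sin (c * (x - d)))\<^sup>2 / (pi\<^sup>2 * x\<^sup>2))"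
    and "(LBINT x:{a..b}. (sin (c * (x - d)))\<^sup>2 / (pi\<^sup>2 * x\<^sup>2)) \<le> 1 / (real n + 1)\<^sup>2"
proof -
  show "0 \<le> (LBINT x:{a..b}. (sin (c * (x - d)))\<^sup>2 / (pi\<^sup>2 * x\<^sup>2))"
    unfolding set_lebesgue_integral_def by (intro integral_nonneg_AE) auto
  have "(LBINT x:{a..b}. (sin (c * (x - d)))\<^sup>2 / (pi\<^sup>2 * x\<^sup>2)) \<le> (LINT x|lborel. indicator {a..b} x * (1 / (real n + 1)\<^sup>2))"
    unfolding set_lebesgue_integral_def
  proof (rule integral_mono')
    show "integrable lborel (\<lambda>x. indicat_real {a..b} x * (1 / (real n + 1)\<^sup>2))"
      by (intro integrable_mult_left integrable_real_indicator) (auto simp: emeasure_lborel_Icc_eq)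
    show "indicat_real {a..b} x *\<^sub>R ((sin (c * (x - d)))\<^sup>2 / (pi\<^sup>2 * x\<^sup>2)) \<le> indicat_real {a..b} x * (1 / (real n + 1)\<^sup>2)" for x
    proof (cases "x \<in> {a..b}")
      case True
      have "(sin (c * (x - d)))\<^sup>2 \<le> 1"
        using abs_sin_le_one by (simp add: abs_square_le_1)
      moreover have "real n + 1 \<le> 2 * x" "0 \<le> x" using True assms by auto
      then have "real n + 1 \<le> pi * x"
        using mult_right_mono[OF pi_ge_two \<open>0 \<le> x\<close>] by linarith
      then have "(real n + 1)\<^sup>2 \<le> (pi * x)\<^sup>2" by (intro power_mono) auto
      ultimately have "(sin (c * (x - d)))\<^sup>2 / (pi\<^sup>2 * x\<^sup>2) \<le> 1 / (real n + 1)\<^sup>2"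
        unfolding power_mult_distrib by (intro frac_le) auto
      then show ?thesis using True by simp
    qed simp
  qed simp
  also have "\<dots> = measure lborel {a..b} * (1 / (real n + 1)\<^sup>2)"
    by simp
  also have "\<dots> \<le> 1 * (1 / (real n + 1)\<^sup>2)"
    using assms(2) by (intro mult_right_mono) auto
  also have "\<dots> = 1 / (real n + 1)\<^sup>2" by simp
  finally show "(LBINT x:{a..b}. (sin (c * (x - d)))\<^sup>2 / (pi\<^sup>2 * x\<^sup>2)) \<le> 1 / (real n + 1)\<^sup>2" .
qed

lemma summable_inverse_square: "summable (\<lambda>n. 1 / (real n + 1)\<^sup>2)"
proof -
  have "summable (\<lambda>n. inverse (real (Suc n) ^ 2))"
    using inverse_power_summable[of 2, where 'a = real] by (subst summable_Suc_iff) auto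
  then show ?thesis by (simp add: divide_inverse add.commute)
qed

lemma sinc_square_lobe_split:
  "(LBINT u:{2 * real n + 2..2 * real n + 3}. sinc_square u) =
     (LBINT u:{2 * real n + 2..2 * real n + 5/2}. sinc_square u) + (LBINT u:{2 * real n + 5/2..2 * real n + 3}. sinc_square u)"
proof -
  have "{2 * real n + 2..2 * real n + 3} = {2 * real n + 2..2 * real n + 5/2} \<union> {2 * real n + 5/2..2 * real n + 3}"
    by auto
  moreover have "set_integrable lborel {a..b} sinc_square" if "0 < a" for a b
    using set_integrable_sin_square_over_square[OF that, of b pi 0] by (simp add: sinc_square_def[abs_def])
  moreover have "AE u in lborel. \<not> (u \<in> {2 * real n + 2..2 * real n + 5/2} \<and> u \<in> {2 * real n + 5/2..2 * real n + 3})"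
    by (rule AE_I'[of "{2 * real n + 5/2}"]) (auto simp: null_sets_def)
  ultimately show ?thesis
    by (simp only:, intro set_integral_Un_AE) auto
qed

text \<open>
  The first integral rescales exactly. In the two series the shift changes at \<open>u = 2 * n + 5/2\<close>, the centre of the
  interval \<open>{2 * n + 2..2 * n + 3}\<close>: its left half is covered by the term with shift \<open>n\<close> of the first series and its right
  half by the term with shift \<open>n + 1\<close> of the second one.
\<close>
lemma sine_lobe_series_ge:
  assumes "4 \<le> p" "p \<le> 5"
  assumes L: "(\<lambda>n. LBINT u:{2 * real n + 2..2 * real n + 3}. sinc_square u) sums T"
  shows "p * (LBINT u:{0..1}. sinc_square u) + 16 / p * T \<le>
    2 * (LBINT x:{0..2/p}. (sin (p/2 * pi * x))\<^sup>2 / (pi\<^sup>2 * x\<^sup>2))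
     + 2 * (\<Sum>n::nat. LBINT x:{real n + 4/p..real n + 1/2 + 3/p}.
             (sin (p/2 * pi * (x - real n)))\<^sup>2 / (pi\<^sup>2 * x\<^sup>2))
     + 2 * (\<Sum>n::nat. LBINT x:{real n + 1/2 + 3/p..real n + 1 + 2/p}.
             (sin (p/2 * pi * (x - real n - 1)))\<^sup>2 / (pi\<^sup>2 * x\<^sup>2))"
proof -
  define v where "v = 1 / p"
  have v: "1 \<le> 5 * v" "4 * v \<le> 1" "0 < v"
    using assms by (auto simp: v_def field_simps)
  have pv: "2/p = 2 * v" "3/p = 3 * v" "4/p = 4 * v"
    by (auto simp: v_def)
  define b where "b = (\<lambda>n. LBINT x:{real n + 4/p..real n + 1/2 + 3/p}. (sin (p/2 * pi * (x - real n)))\<^sup>2 / (pi\<^sup>2 * x\<^sup>2))"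
  define c where "c = (\<lambda>n. LBINT x:{real n + 1/2 + 3/p..real n + 1 + 2/p}. (sin (p/2 * pi * (x - real n - 1)))\<^sup>2 / (pi\<^sup>2 * x\<^sup>2))"
  have "0 \<le> b n \<and> b n \<le> 1 / (real n + 1)\<^sup>2" for n
    unfolding b_def pv using v of_nat_0_le_iff[of n, where 'a = real] by (intro conjI lobe_integral_bounds[where n = n]) (simp_all add: algebra_simps)
  then have "summable b"
    by (intro summable_comparison_test'[OF summable_inverse_square]) auto
  have "0 \<le> c n \<and> c n \<le> 1 / (real n + 1)\<^sup>2" for n
    unfolding c_def diff_diff_eq pv using v of_nat_0_le_iff[of n, where 'a = real] by (intro conjI lobe_integral_bounds[where n = n]) (simp_all add: algebra_simps)
  then have "summable c"
    by (intro summable_comparison_test'[OF summable_inverse_square]) auto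
  have ge: "8 / p * (LBINT u:{2 * real n + 2..2 * real n + 3}. sinc_square u) \<le> b n + c n" for n
  proof -
    have "8 / p * (LBINT u:{2 * real n + 2..2 * real n + 5/2}. sinc_square u) \<le> b n"
      unfolding b_def
    proof (rule lobe_integral_ge)
      fix u assume u: "2 * real n + 2 \<le> u" "u \<le> 2 * real n + 5/2"
      have "2 * v * 2 \<le> 2 * v * (u - 2 * real n)" "2 * v * (u - 2 * real n) \<le> 2 * v * (5/2)"
        using u v by (auto intro!: mult_left_mono)
      then show "real n + 2 / p * (u - 2 * real n) \<in> {real n + 4 / p..real n + 1 / 2 + 3 / p}"
        using v unfolding pv atLeastAtMost_iff by (intro conjI; linarith)
    qed (use v assms in \<open>simp_all add: pv\<close>)
    moreover have "8 / p * (LBINT u:{2 * real n + 5/2..2 * real n + 3}. sinc_square u) \<le>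
        (LBINT x:{real n + 1/2 + 3/p..real n + 1 + 2/p}. (sin (p/2 * pi * (x - real (n + 1))))\<^sup>2 / (pi\<^sup>2 * x\<^sup>2))"
    proof (rule lobe_integral_ge)
      fix u assume u: "2 * real n + 5/2 \<le> u" "u \<le> 2 * real n + 3"
      have "2 * v * (1/2) \<le> 2 * v * (u - 2 * real (n + 1))" "2 * v * (u - 2 * real (n + 1)) \<le> 2 * v * 1"
        using u v by (auto intro!: mult_left_mono)
      then show "real (n + 1) + 2 / p * (u - 2 * real (n + 1)) \<in> {real n + 1/2 + 3/p..real n + 1 + 2/p}"
        using v unfolding pv atLeastAtMost_iff by (intro conjI; linarith)
    qed (use v assms in \<open>simp_all add: pv\<close>)
    ultimately show ?thesis
      unfolding sinc_square_lobe_split distrib_left by (simp add: c_def algebra_simps)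
  qed
  have "8 / p * T \<le> (\<Sum>n. b n + c n)"
    using sums_le[OF ge sums_mult[OF L] summable_sums[OF summable_add[OF \<open>summable b\<close> \<open>summable c\<close>]]] .
  also have "\<dots> = suminf b + suminf c"
    using \<open>summable b\<close> \<open>summable c\<close> by (simp add: suminf_add)
  finally have "16 / p * T \<le> 2 * suminf b + 2 * suminf c"
    by (simp add: v_def)
  moreover have "2 * (LBINT x:{0..2/p}. (sin (p/2 * pi * x))\<^sup>2 / (pi\<^sup>2 * x\<^sup>2)) = p * (LBINT u:{0..1}. sinc_square u)"
    using assms by (subst first_integral_rescaled) auto
  ultimately show ?thesis
    unfolding b_def c_def by linarith
qed

section \<open>Numerical bounds on the first lobe\<close>

lemma maclaurin_sin_bound:
  "\<bar>sin x - (\<Sum>m<n. sin_coeff m * x ^ m)\<bar> \<le> \<bar>x\<bar> ^ n / fact n" for x :: real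
proof -
  obtain t where "sin x = (\<Sum>m<n. sin_coeff m * x ^ m) + (sin (t + 1/2 * real n * pi) / fact n) * x ^ n"
    using Maclaurin_sin_expansion by blast
  then have "\<bar>sin x - (\<Sum>m<n. sin_coeff m * x ^ m)\<bar> = \<bar>sin (t + 1/2 * real n * pi)\<bar> * (\<bar>x\<bar> ^ n / fact n)"
    by (simp add: abs_mult power_abs)
  also have "\<dots> \<le> 1 * (\<bar>x\<bar> ^ n / fact n)"
    by (intro mult_right_mono abs_sin_le_one) auto
  finally show ?thesis by simp
qed

lemma maclaurin_cos_bound:
  "\<bar>cos x - (\<Sum>m<n. cos_coeff m * x ^ m)\<bar> \<le> \<bar>x\<bar> ^ n / fact n" for x :: real
proof -
  obtain t where "cos x = (\<Sum>m<n. cos_coeff m * x ^ m) + (cos (t + 1/2 * real n * pi) / fact n) * x ^ n"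
    using Maclaurin_cos_expansion by blast
  then have "\<bar>cos x - (\<Sum>m<n. cos_coeff m * x ^ m)\<bar> = \<bar>cos (t + 1/2 * real n * pi)\<bar> * (\<bar>x\<bar> ^ n / fact n)"
    by (simp add: abs_mult power_abs)
  also have "\<dots> \<le> 1 * (\<bar>x\<bar> ^ n / fact n)"
    by (intro mult_right_mono abs_cos_le_one) auto
  finally show ?thesis by simp
qed

text \<open>
  The signs of the cosine at 1.5707 and at 1.5708, read off from its Taylor polynomial, locate \<open>pi / 2\<close>.
\<close>
lemma pi_bounds: "31414 / 10000 < pi" "pi < 31416 / 10000"
proof -
  have taylor: "(\<Sum>m<12. cos_coeff m * x ^ m) = 1 - x^2/2 + x^4/24 - x^6/720 + x^8/40320 - x^10/3628800" for x :: real
    by (simp add: cos_coeff_def lessThan_nat_numeral fact_numeral)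
  have "0 < 1 - (15707/10000)^2/2 + (15707/10000)^4/24 - (15707/10000)^6/720 + (15707/10000)^8/40320
      - (15707/10000)^10/3628800 - \<bar>15707/10000\<bar> ^ 12 / (fact 12 :: real)"
    by (simp add: fact_numeral power_divide)
  then have "0 < cos (15707/10000 :: real)"
    using maclaurin_cos_bound[of "15707/10000" 12] unfolding taylor by linarith
  moreover have "cos (15707/10000 :: real) \<le> 0" if "pi \<le> 31414 / 10000"
    using that pi_ge_two cos_monotone_0_pi_le[of "pi/2" "15707/10000"] by simp
  ultimately show "31414 / 10000 < pi" by linarith
  have "1 - (3927/2500)^2/2 + (3927/2500)^4/24 - (3927/2500)^6/720 + (3927/2500)^8/40320
      - (3927/2500)^10/3628800 + \<bar>3927/2500\<bar> ^ 12 / (fact 12 :: real) < 0"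
    by (simp add: fact_numeral power_divide)
  then have "cos (3927/2500 :: real) < 0"
    using maclaurin_cos_bound[of "3927/2500" 12] unfolding taylor by linarith
  moreover have "0 \<le> cos (3927/2500 :: real)" if "31416 / 10000 \<le> pi"
    using that by (intro cos_ge_zero) auto
  ultimately show "pi < 31416 / 10000" by linarith
qed

lemma set_integral_monomial: "(LBINT u:{0..1}. c * u ^ n) = c / (real n + 1)"
proof -
  have "integral\<^sup>L lborel (\<lambda>u. indicator {0..1} u *\<^sub>R (c * u ^ n)) = c / real (Suc n) * 1 ^ Suc n - c / real (Suc n) * 0 ^ Suc n"
  proof (rule integral_FTC_atLeastAtMost)
    fix x :: real
    have "((\<lambda>u. c / real (Suc n) * u ^ Suc n) has_real_derivative c / real (Suc n) * (real (Suc n) * x ^ n)) (at x within {0..1})"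
      using DERIV_cmult[OF DERIV_pow[of "Suc n" x "{0..1}"], of "c / real (Suc n)"] by simp
    then show "((\<lambda>u. c / real (Suc n) * u ^ Suc n) has_vector_derivative c * x ^ n) (at x within {0..1})"
      by (simp add: has_real_derivative_iff_has_vector_derivative)
  qed (auto intro!: continuous_intros)
  then show ?thesis by (simp only: set_lebesgue_integral_def) simp
qed

lemma sinc_pos_squared_eq:
  assumes "2 * real k \<le> u" "u \<le> 2 * real k + 1"
  shows "sinc_pos u powr 2 = sinc_square u"
proof -
  have "sinc_pos u powr 2 = (sinc_pos u)\<^sup>2"
    using sinc_pos_nonneg by (rule powr_numeral)
  then show ?thesis
    by (simp add: sinc_pos_eq[OF assms] sinc_square_def power_divide power_mult_distrib)
qed

text \<open>
  The tangent to the concave function \<open>s powr (2/3)\<close> at \<open>s = (9/10) ^ 3\<close>, multiplied by \<open>s\<close>. It replaces a fractional power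
  by a quadratic polynomial, whose integrals are explicit; the point of contact is chosen near the typical size of sinc
  on \<open>{0..1}\<close> and also serves for the sine on the later intervals.
\<close>
lemma powr_five_thirds_le:
  fixes s :: real
  assumes "0 \<le> s"
  shows "s powr (5/3) \<le> 27/100 * s + 20/27 * s\<^sup>2"
proof (cases "s = 0")
  case False
  then have "s > 0" using assms by simp
  define r where "r = s powr (1/3)"
  have "r > 0" using \<open>s > 0\<close> by (simp add: r_def)
  have r3: "r ^ 3 = s"
    using \<open>s > 0\<close> by (simp add: r_def powr_power)
  have "s powr (5/3) = r ^ 5"
    using \<open>s > 0\<close> by (simp add: r_def powr_power)
  moreover have "27/100 * s + 20/27 * s\<^sup>2 - r ^ 5 = 20/27 * r ^ 3 * (r - 9/10)\<^sup>2 * (r + 9/20)"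
    unfolding r3[symmetric] by (simp add: field_simps power2_eq_square eval_nat_numeral)
  moreover have "0 \<le> 20/27 * r ^ 3 * (r - 9/10)\<^sup>2 * (r + 9/20)"
    using \<open>r > 0\<close> by (intro mult_nonneg_nonneg) auto
  ultimately show ?thesis by linarith
qed simp

lemma set_integrable_monomial: "set_integrable lborel {0..1} (\<lambda>u::real. c * u ^ n)"
  by (intro borel_integrable_atLeastAtMost' continuous_intros)

lemma set_integral_polynomial:
  "set_integrable lborel {0..1} (\<lambda>u::real. \<Sum>k\<le>n. c k * u ^ (2 * k))"
  "(LBINT u:{0..1}. \<Sum>k\<le>n. c k * u ^ (2 * k)) = (\<Sum>k\<le>n. c k / (2 * real k + 1))"
proof -
  show "set_integrable lborel {0..1} (\<lambda>u::real. \<Sum>k\<le>n. c k * u ^ (2 * k))"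
    by (intro borel_integrable_atLeastAtMost' continuous_intros)
  have "(LBINT u:{0..1}. \<Sum>k\<le>n. c k * u ^ (2 * k)) = (\<Sum>k\<le>n. LBINT u:{0..1}. c k * u ^ (2 * k))"
    unfolding set_lebesgue_integral_def scaleR_sum_right
    using set_integrable_monomial by (intro Bochner_Integration.integral_sum) (auto simp: set_integrable_def)
  then show "(LBINT u:{0..1}. \<Sum>k\<le>n. c k * u ^ (2 * k)) = (\<Sum>k\<le>n. c k / (2 * real k + 1))"
    unfolding set_integral_monomial by simp
qed

lemma pi_square_bounds: "98683/10000 \<le> pi\<^sup>2" "pi\<^sup>2 \<le> 98697/10000"
proof -
  have "(31414 / 10000)\<^sup>2 \<le> pi\<^sup>2" "pi\<^sup>2 \<le> (31416 / 10000)\<^sup>2"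
    using pi_bounds by (intro power_mono; simp)+
  then show "98683/10000 \<le> pi\<^sup>2" "pi\<^sup>2 \<le> 98697/10000"
    by (auto simp: power2_eq_square)
qed

text \<open>
  The true value is about 0.5895. The last term of the polynomial is the Taylor remainder.
\<close>
lemma sinc_pos_main_lobe_integral_le: "(LBINT u:{0..1}. sinc_pos u) \<le> 59/100"
proof -
  define y where "y = pi\<^sup>2"
  define c where "c = (\<lambda>k::nat. (-1) ^ k * y ^ k / fact (2 * k + 1))"
  have le: "sinc_pos u \<le> (\<Sum>k\<le>6. c k * u ^ (2 * k))" if "u \<in> {0..1}" for u
  proof (cases "u = 0")
    case True
    then show ?thesis by (simp add: sinc_pos_def c_def atMost_nat_numeral)
  next
    case False
    define x where "x = pi * u"
    have "x > 0" using that False by (simp add: x_def)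
    have taylor: "(\<Sum>m<13. sin_coeff m * x ^ m) = x - x^3/6 + x^5/120 - x^7/5040 + x^9/362880 - x^11/39916800"
      by (simp add: sin_coeff_def lessThan_nat_numeral fact_numeral)
    have "sin x \<le> x - x^3/6 + x^5/120 - x^7/5040 + x^9/362880 - x^11/39916800 + x^13/6227020800"
    proof -
      have "\<bar>x\<bar> ^ 13 / fact 13 = x ^ 13 / 6227020800"
        using \<open>x > 0\<close> by (simp add: fact_numeral)
      then show ?thesis
        using maclaurin_sin_bound[of x 13] unfolding taylor by linarith
    qed
    also have "\<dots> = x * (\<Sum>k\<le>6. c k * u ^ (2 * k))"
      by (simp add: c_def atMost_nat_numeral fact_numeral y_def x_def power_mult_distrib distrib_left flip: power_mult)
         (simp add: field_simps eval_nat_numeral)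
    finally have "sin x / x \<le> (\<Sum>k\<le>6. c k * u ^ (2 * k))"
      using \<open>x > 0\<close> by (simp add: divide_le_eq mult.commute)
    then show ?thesis
      using sinc_pos_eq[of 0 u] that by (simp add: x_def)
  qed
  have "(LBINT u:{0..1}. sinc_pos u) \<le> (LBINT u:{0..1}. \<Sum>k\<le>6. c k * u ^ (2 * k))"
    unfolding set_lebesgue_integral_def
  proof (rule integral_mono')
    show "integrable lborel (\<lambda>u. indicat_real {0..1} u *\<^sub>R (\<Sum>k\<le>6. c k * u ^ (2 * k)))"
      using set_integral_polynomial(1) by (simp add: set_integrable_def)
    show "indicat_real {0..1} u *\<^sub>R sinc_pos u \<le> indicat_real {0..1} u *\<^sub>R (\<Sum>k\<le>6. c k * u ^ (2 * k))" for u
      using le[of u] by (simp split: split_indicator)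
    show "0 \<le> indicat_real {0..1} u *\<^sub>R (\<Sum>k\<le>6. c k * u ^ (2 * k))" for u
      by (auto split: split_indicator intro: order_trans[OF sinc_pos_nonneg le])
  qed
  also have "\<dots> = (\<Sum>k\<le>6. c k / (2 * real k + 1))"
    by (rule set_integral_polynomial(2))
  also have "\<dots> = 1 - y / 18 + y^2 / 600 - y^3 / 35280 + y^4 / 3265920 - y^5 / 439084800 + y^6 / 80951270400"
    by (simp add: c_def atMost_nat_numeral fact_numeral)
  also have "\<dots> \<le> 59/100"
  proof -
    have y: "98683/10000 \<le> y" "y \<le> 98697/10000"
      using pi_square_bounds by (auto simp: y_def)
    have "(98683/10000) ^ n \<le> y ^ n" "y ^ n \<le> (98697/10000) ^ n" for n
      using y by (intro power_mono; simp)+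
    \<comment> \<open>Each power is bounded in the direction required by the sign of its coefficient.\<close>
    note pw = this(2)[of 2] this(1)[of 3] this(2)[of 4] this(1)[of 5] this(2)[of 6]
    show ?thesis
      using y pw by (simp add: power_divide)
  qed
  finally show ?thesis .
qed

text \<open>
  The true value is about 0.4514. From \<open>sinc_square u = 2 * (1 - cos z) / z\<^sup>2\<close> with \<open>z = 2 * pi * u\<close> one obtains an alternating
  series in \<open>z\<^sup>2\<close>; ten terms are kept, and the eleventh coefficient, taken with a negative sign, accounts for the
  remainder.
\<close>
lemma sinc_square_main_lobe_integral_ge: "45/100 \<le> (LBINT u:{0..1}. sinc_square u)"
proof -
  define y where "y = 4 * pi\<^sup>2"
  \<comment> \<open>The coefficient with \<open>k = 10\<close> is the negative of the Taylor remainder, not the next term of the series.\<close>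
  define c where "c = (\<lambda>k::nat. (if k = 10 then -1 else (-1)^k) * 2 * y ^ k / fact (2 * (k + 1)))"
  have le: "(\<Sum>k\<le>10. c k * u ^ (2 * k)) \<le> sinc_square u" if "u \<noteq> 0" for u
  proof -
    define z where "z = 2 * pi * u"
    have "z \<noteq> 0" using that by (simp add: z_def)
    have z2: "z ^ (2 * k) = y ^ k * u ^ (2 * k)" for k
      by (simp add: z_def y_def power_mult power_mult_distrib)
    have taylor: "(\<Sum>m<22. cos_coeff m * z ^ m) = 1 + (\<Sum>k\<le>9. (-1)^(k+1) * z^(2 * (k + 1)) / fact (2 * (k + 1)))"
      by (simp add: cos_coeff_def lessThan_nat_numeral atMost_nat_numeral fact_numeral) (simp add: eval_nat_numeral)
    have "cos z \<le> 1 + (\<Sum>k\<le>9. (-1)^(k+1) * z^(2 * (k + 1)) / fact (2 * (k + 1))) + z ^ 22 / fact 22"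
      using maclaurin_cos_bound[of z 22] unfolding taylor by (simp add: abs_le_iff)
    then have "(\<Sum>k\<le>9. (-1)^k * z^(2 * (k + 1)) / fact (2 * (k + 1))) - z ^ 22 / fact 22 \<le> 1 - cos z"
      by (simp add: sum_negf)
    also have "(\<Sum>k\<le>9. (-1)^k * z^(2 * (k + 1)) / fact (2 * (k + 1))) - z ^ 22 / fact 22
       = z\<^sup>2 / 2 * (\<Sum>k\<le>10. c k * u ^ (2 * k))"
    proof -
      have "z\<^sup>2 / 2 * (\<Sum>k\<le>10. c k * u ^ (2 * k)) = (\<Sum>k\<le>10. (if k = 10 then -1 else (-1)^k) * z ^ (2 * (k + 1)) / fact (2 * (k + 1)))"
        unfolding c_def sum_distrib_left by (intro sum.cong) (auto simp: power_add z2 power2_eq_square)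
      also have "\<dots> = (\<Sum>k\<le>9. (-1)^k * z^(2 * (k + 1)) / fact (2 * (k + 1))) - z ^ 22 / fact 22"
        by (simp add: atMost_nat_numeral fact_numeral) (simp add: eval_nat_numeral)
      finally show ?thesis by simp
    qed
    finally have "(\<Sum>k\<le>10. c k * u ^ (2 * k)) \<le> 2 * (1 - cos z) / z\<^sup>2"
      using \<open>z \<noteq> 0\<close> by (simp add: field_simps)
    also have "\<dots> = sinc_square u"
      using cos_double_sin[of "pi * u"] by (simp add: z_def sinc_square_def power_mult_distrib mult.assoc)
    finally show ?thesis .
  qed
  have "(\<Sum>k\<le>10. c k / (2 * real k + 1)) = (LBINT u:{0..1}. \<Sum>k\<le>10. c k * u ^ (2 * k))"
    by (rule set_integral_polynomial(2)[symmetric])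
  also have "\<dots> \<le> (LBINT u:{0..1}. sinc_square u)"
    unfolding set_lebesgue_integral_def
  proof (rule integral_mono_AE)
    show "integrable lborel (\<lambda>u. indicat_real {0..1} u *\<^sub>R (\<Sum>k\<le>10. c k * u ^ (2 * k)))"
      using set_integral_polynomial(1) by (simp add: set_integrable_def)
    have eq: "(\<lambda>u. indicat_real {0..1} u *\<^sub>R sinc_square u) = (\<lambda>u. indicat_real {0..1} u *\<^sub>R (sinc_pos u powr 2))"
      using sinc_pos_squared_eq[of 0] by (auto split: split_indicator)
    show "integrable lborel (\<lambda>u. indicat_real {0..1} u *\<^sub>R sinc_square u)"
      unfolding eq by (intro integrable_mult_indicator integrable_sinc_pos_powr) auto
    show "AE u in lborel. indicat_real {0..1} u *\<^sub>R (\<Sum>k\<le>10. c k * u ^ (2 * k)) \<le> indicat_real {0..1} u *\<^sub>R sinc_square u"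
      using AE_lborel_singleton[of 0] by eventually_elim (use le in \<open>auto split: split_indicator\<close>)
  qed
  finally have "(\<Sum>k\<le>10. c k / (2 * real k + 1)) \<le> (LBINT u:{0..1}. sinc_square u)" .
  moreover have "45/100 \<le> (\<Sum>k\<le>10. c k / (2 * real k + 1))"
  proof -
    have y: "98683/2500 \<le> y" "y \<le> 98697/2500"
      using pi_square_bounds by (auto simp: y_def)
    have "(98683/2500) ^ n \<le> y ^ n" "y ^ n \<le> (98697/2500) ^ n" for n
      using y by (intro power_mono; simp)+
    note pw = this(1)[of 2] this(2)[of 3] this(1)[of 4] this(2)[of 5] this(1)[of 6] this(2)[of 7] this(1)[of 8] this(2)[of 9] this(2)[of 10]
    have "(\<Sum>k\<le>10. c k / (2 * real k + 1)) = 1 - y / 36 + y^2 / 1800 - y^3 / 141120 + y^4 / 16329600 - y^5 / 2634508800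
       + y^6 / 566658892800 - y^7 / 156920924160000 + y^8 / 54420176498688000 - y^9 / 23112569077678080000 - y^10 / 11802007641664880640000"
      by (simp add: c_def atMost_nat_numeral fact_numeral)
    then show ?thesis
      using y pw by (simp add: power_divide)
  qed
  ultimately show ?thesis by linarith
qed

section \<open>Numerical bounds on the tail\<close>

lemma powr_convex_neg:
  assumes "p \<le> 0" shows "convex_on {0<..} (\<lambda>x::real. x powr p)"
proof (rule f''_ge0_imp_convex)
  show "((\<lambda>x. x powr p) has_real_derivative p * x powr (p - 1)) (at x)" if "x \<in> {0<..}" for x
    using that by (auto intro!: derivative_eq_intros)
  show "((\<lambda>x. p * x powr (p - 1)) has_real_derivative p * ((p - 1) * x powr (p - 1 - 1))) (at x)" if "x \<in> {0<..}" for x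
    using that by (auto intro!: derivative_eq_intros)
  show "0 \<le> p * ((p - 1) * x powr (p - 1 - 1))" if "x \<in> {0<..}" for x
    using assms by (simp add: zero_le_mult_iff mult_le_0_iff)
qed auto

text \<open>
  The integral of the convex function \<open>x powr (-5/3)\<close> over an interval of length 1 is at least its value at the midpoint;
  \<open>- 3/2 * x powr (-2/3)\<close> is a primitive.
\<close>
lemma powr_neg_five_thirds_midpoint:
  fixes x :: real
  assumes "1 \<le> x"
  shows "x powr (-5/3) \<le> 3/2 * (x - 1/2) powr (-2/3) - 3/2 * (x + 1/2) powr (-2/3)"
proof -
  \<comment> \<open>Vanishes at 0; its derivative is nonnegative by convexity, and its value at \<open>1/2\<close> is the claim.\<close>
  define \<phi> where "\<phi> = (\<lambda>t. 3/2 * (x - t) powr (-2/3) - 3/2 * (x + t) powr (-2/3) - 2 * t * x powr (-5/3))"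
  have "\<phi> 0 \<le> \<phi> (1/2)"
  proof (rule DERIV_nonneg_imp_nondecreasing[where f = \<phi>])
    fix t :: real assume t: "0 \<le> t" "t \<le> 1/2"
    have "(\<phi> has_real_derivative (x - t) powr (-5/3) + (x + t) powr (-5/3) - 2 * x powr (-5/3)) (at t)"
      unfolding \<phi>_def using t assms by (auto intro!: derivative_eq_intros)
    moreover have "x powr (-5/3) \<le> 1/2 * (x - t) powr (-5/3) + 1/2 * (x + t) powr (-5/3)"
      using convex_onD[OF powr_convex_neg[of "-5/3"], of "1/2" "x - t" "x + t"] t assms by (simp add: field_simps)
    ultimately show "\<exists>d. (\<phi> has_real_derivative d) (at t) \<and> 0 \<le> d"
      by (intro exI conjI) (assumption, linarith)
  qed simp
  then show ?thesis by (simp add: \<phi>_def)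
qed

text \<open>
  Because of the symmetry of the sine about the midpoint of the interval, the linear factor contributes its value
  there.
\<close>
lemma set_integral_sin_times_linear:
  fixes K :: nat and \<alpha> \<beta> b c :: real
  shows "(LBINT u:{real K..real K + 1}. (b * sin (pi * (u - real K)) + c * (sin (pi * (u - real K)))\<^sup>2) * (\<alpha> + \<beta> * (u - real K)))
    = (2 * b / pi + c / 2) * (\<alpha> + \<beta> / 2)"
proof -
  define G where "G = (\<lambda>u. let v = u - real K in
     b * (\<alpha> * (- cos (pi * v) / pi) + \<beta> * (- v * cos (pi * v) / pi + sin (pi * v) / pi\<^sup>2))
   + c * (\<alpha> * (v / 2 - sin (2 * pi * v) / (4 * pi)) + \<beta> * (v\<^sup>2 / 4 - v * sin (2 * pi * v) / (4 * pi) - cos (2 * pi * v) / (8 * pi\<^sup>2))))"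
  have "(LBINT u:{real K..real K + 1}. (b * sin (pi * (u - real K)) + c * (sin (pi * (u - real K)))\<^sup>2) * (\<alpha> + \<beta> * (u - real K)))
      = G (real K + 1) - G (real K)"
    unfolding set_lebesgue_integral_def
  proof (rule integral_FTC_atLeastAtMost)
    fix u :: real
    define v where "v = u - real K"
    have "(sin (pi * v))\<^sup>2 = 1/2 - cos (2 * pi * v) / 2"
      using cos_double_sin[of "pi * v"] by (simp add: mult.assoc diff_divide_distrib)
    moreover have "(G has_real_derivative b * sin (pi * v) * (\<alpha> + \<beta> * v) + c * (1/2 - cos (2 * pi * v) / 2) * (\<alpha> + \<beta> * v)) (at u within {real K..real K + 1})"
      unfolding G_def Let_def v_def
      by (rule derivative_eq_intros refl | simp)+ (simp add: field_simps eval_nat_numeral)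
    ultimately show "(G has_vector_derivative (b * sin (pi * (u - real K)) + c * (sin (pi * (u - real K)))\<^sup>2) * (\<alpha> + \<beta> * (u - real K))) (at u within {real K..real K + 1})"
      by (simp add: has_real_derivative_iff_has_vector_derivative v_def distrib_right)
  qed (auto intro!: continuous_intros)
  also have "\<dots> = (2 * b / pi + c / 2) * (\<alpha> + \<beta> / 2)"
    by (simp add: G_def Let_def field_simps power2_eq_square)
  finally show ?thesis .
qed

lemma sin_lobe_eq:
  fixes k :: nat
  shows "sin (pi * u) = sin (pi * (u - real (2 * k)))"
  using sin.plus_of_nat[of "pi * (u - real (2 * k))" k] by (simp add: algebra_simps)

text \<open>
  On one interval \<open>{K..K + 1}\<close> the fractional power of the sine is bounded by a quadratic polynomial and the convex factor
  \<open>u powr (-5/3)\<close> by its chord, so apart from the factor \<open>pi powr (-5/3)\<close> the integral is at most the average \<open>A\<close> of the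
  sine part times the mean of \<open>K powr (-5/3)\<close> and \<open>(K + 1) powr (-5/3)\<close>. The midpoint inequality then makes the sum over all intervals telescope.
\<close>
lemma sinc_pos_tail_lobe_le:
  fixes k :: nat
  defines "A \<equiv> 27/50 / pi + 10/27" and "H \<equiv> \<lambda>k. 3/2 * (2 * real k + 3/2) powr (-2/3)"
  shows "(LBINT u:{2 * real k + 2..2 * real k + 3}. sinc_pos u powr (5/3)) \<le> A / 2 * pi powr (-5/3) * (H k - H (Suc k))"
proof -
  define K where "K = 2 * (k + 1)"
  define g where "g = (\<lambda>u::real. u powr (-5/3))"
  define \<alpha> where "\<alpha> = g (real K)"
  define \<beta> where "\<beta> = g (real K + 1) - g (real K)"
  define \<sigma> where "\<sigma> = (\<lambda>u. sin (pi * (u - real K)))"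
  have "A > 0" by (simp add: A_def add_pos_pos)
  have K: "2 * real k + 2 = real K" "2 * real k + 3 = real K + 1"
    by (simp_all add: K_def)
  have "2 \<le> real K" by (simp add: K_def)
  have le: "sinc_pos u powr (5/3) \<le> pi powr (-5/3) * ((27/100 * \<sigma> u + 20/27 * (\<sigma> u)\<^sup>2) * (\<alpha> + \<beta> * (u - real K)))"
    if u: "u \<in> {real K..real K + 1}" for u
  proof -
    have "u > 0" using u \<open>2 \<le> real K\<close> by simp
    have "0 \<le> \<sigma> u"
      unfolding \<sigma>_def using u by (intro sin_ge_zero) (auto simp: mult_le_cancel_left1)
    have eq: "sinc_pos u = \<sigma> u / (pi * u)"
      using sinc_pos_eq[of "k + 1" u] u sin_lobe_eq[of u "k + 1"] by (simp add: \<sigma>_def K_def algebra_simps)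
    have "sinc_pos u powr (5/3) = \<sigma> u powr (5/3) * (pi powr (-5/3) * g u)"
      unfolding eq using \<open>0 \<le> \<sigma> u\<close> \<open>u > 0\<close> by (simp add: powr_divide powr_mult powr_minus_divide g_def)
    also have "\<dots> \<le> (27/100 * \<sigma> u + 20/27 * (\<sigma> u)\<^sup>2) * (pi powr (-5/3) * (\<alpha> + \<beta> * (u - real K)))"
    proof (intro mult_mono powr_five_thirds_le mult_left_mono)
      have "g ((1 - (u - real K)) *\<^sub>R real K + (u - real K) *\<^sub>R (real K + 1)) \<le> (1 - (u - real K)) * g (real K) + (u - real K) * g (real K + 1)"
        using u \<open>2 \<le> real K\<close> unfolding g_def by (intro convex_onD[OF powr_convex_neg]) auto
      moreover have "(1 - (u - real K)) *\<^sub>R real K + (u - real K) *\<^sub>R (real K + 1) = u"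
        by (simp add: algebra_simps)
      ultimately show "g u \<le> \<alpha> + \<beta> * (u - real K)"
        by (simp add: \<alpha>_def \<beta>_def algebra_simps)
    qed (use \<open>0 \<le> \<sigma> u\<close> in \<open>auto simp: g_def\<close>)
    finally show ?thesis by (simp add: mult_ac)
  qed
  let ?R = "\<lambda>u. pi powr (-5/3) * ((27/100 * \<sigma> u + 20/27 * (\<sigma> u)\<^sup>2) * (\<alpha> + \<beta> * (u - real K)))"
  have "(LBINT u:{real K..real K + 1}. sinc_pos u powr (5/3)) \<le> (LBINT u:{real K..real K + 1}. ?R u)"
    unfolding set_lebesgue_integral_def
  proof (rule integral_mono')
    have "set_integrable lborel {real K..real K + 1} ?R"
      unfolding \<sigma>_def by (intro borel_integrable_atLeastAtMost' continuous_intros)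
    then show "integrable lborel (\<lambda>u. indicat_real {real K..real K + 1} u *\<^sub>R ?R u)"
      by (simp add: set_integrable_def)
    show "indicat_real {real K..real K + 1} u *\<^sub>R sinc_pos u powr (5/3) \<le> indicat_real {real K..real K + 1} u *\<^sub>R ?R u" for u
      using le[of u] by (auto split: split_indicator)
    show "0 \<le> indicat_real {real K..real K + 1} u *\<^sub>R ?R u" for u
      using order_trans[OF powr_ge_zero le[of u]] by (auto split: split_indicator)
  qed
  also have "\<dots> = pi powr (-5/3) * ((2 * (27/100) / pi + 20/27 / 2) * (\<alpha> + \<beta> / 2))"
    unfolding \<sigma>_def set_integral_mult_right set_integral_sin_times_linear by (rule refl)
  also have "\<dots> = A / 2 * pi powr (-5/3) * (g (real K) + g (real K + 1))"
    by (simp add: A_def \<alpha>_def \<beta>_def field_simps)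
  also have "\<dots> \<le> A / 2 * pi powr (-5/3) * (H k - H (Suc k))"
  proof (intro mult_left_mono)
    show "g (real K) + g (real K + 1) \<le> H k - H (Suc k)"
      using powr_neg_five_thirds_midpoint[of "real K"] powr_neg_five_thirds_midpoint[of "real K + 1"] \<open>2 \<le> real K\<close>
      by (simp add: g_def H_def K_def algebra_simps)
  qed (use \<open>A > 0\<close> in auto)
  finally show ?thesis by (simp add: K)
qed

lemma sinc_pos_tail_sum_le:
  assumes "(\<lambda>k. LBINT u:{2 * real k + 2..2 * real k + 3}. sinc_pos u powr (5/3)) sums T"
  shows "T \<le> 93/2000"
proof -
  define A where "A = 27/50 / pi + 10/27"
  define H where "H = (\<lambda>k. 3/2 * (2 * real k + 3/2) powr (-2/3))"
  have "H \<longlonglongrightarrow> 0"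
  proof -
    have "filterlim (\<lambda>k. 3/2 + 2 * real k) at_top sequentially"
      by (intro filterlim_tendsto_add_at_top[OF tendsto_const] filterlim_tendsto_pos_mult_at_top[OF tendsto_const]
          filterlim_real_sequentially) auto
    then have "(\<lambda>k. (3/2 + 2 * real k) powr (-2/3)) \<longlonglongrightarrow> 0"
      by (intro tendsto_neg_powr) auto
    then show ?thesis
      unfolding H_def by (intro tendsto_mult_right_zero) (simp add: add.commute)
  qed
  have "A > 0" by (simp add: A_def add_pos_pos)
  have "(\<lambda>k. A / 2 * pi powr (-5/3) * (H k - H (Suc k))) sums (A / 2 * pi powr (-5/3) * (H 0 - 0))"
    by (intro sums_mult telescope_sums' \<open>H \<longlonglongrightarrow> 0\<close>)
  moreover have "(LBINT u:{2 * real k + 2..2 * real k + 3}. sinc_pos u powr (5/3)) \<le> A / 2 * pi powr (-5/3) * (H k - H (Suc k))" for k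
    unfolding A_def H_def by (rule sinc_pos_tail_lobe_le)
  ultimately have "T \<le> A / 2 * pi powr (-5/3) * (H 0 - 0)"
    by (intro sums_le[OF _ assms])
  then have "T \<le> A / 2 * pi powr (-5/3) * H 0" by simp
  also have "\<dots> \<le> (54229/100000) / 2 * (1000/6737) * (11448/10000)"
  proof (intro mult_mono)
    have "27/50 / pi \<le> 27/50 / (31414/10000)"
      using pi_bounds by (intro divide_left_mono) auto
    then show "A / 2 \<le> (54229/100000) / 2"
      by (simp add: A_def)
    have "(6737/1000) powr 3 \<le> pi powr 5"
      using power_mono[of "31414/10000" pi 5] pi_bounds by (simp add: power_divide)
    then have "((6737/1000) powr 3) powr (1/3) \<le> (pi powr 5) powr (1/3)"
      by (intro powr_mono2) auto
    also have "(pi powr 5) powr (1/3) = pi powr (5/3)"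
      by (simp only: powr_powr) simp
    also have "((6737/1000) powr 3) powr (1/3) = (6737/1000 :: real)"
      by (simp only: powr_powr) simp
    finally have "6737/1000 \<le> pi powr (5/3)" .
    then show "pi powr (-5/3) \<le> 1000/6737"
      by (simp add: powr_minus field_simps)
    have "H 0 = (3/2) powr 1 * (3/2) powr (-2/3)"
      by (simp add: H_def)
    also have "\<dots> = (3/2) powr (1/3)"
      by (subst powr_add[symmetric]) simp
    also have "\<dots> \<le> ((11448/10000) ^ 3) powr (1/3)"
      by (intro powr_mono2) (auto simp: power_divide)
    also have "\<dots> = 11448/10000"
      by (simp add: powr_powr flip: powr_numeral)
    finally show "H 0 \<le> 11448/10000" .
  qed (use \<open>A > 0\<close> in \<open>auto simp: H_def\<close>)
  also have "\<dots> \<le> 93/2000" by simp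
  finally show ?thesis .
qed

section \<open>Interpolation between the exponents 2 and 5/3\<close>

lemma sinc_pos_lobe_sums:
  assumes "1 < q"
  shows "(\<lambda>k. LBINT u:{2 * real k + 2..2 * real k + 3}. sinc_pos u powr q) sums
      ((LINT u|lborel. sinc_pos u powr q) / 2 - (LBINT u:{0..1}. sinc_pos u powr q))"
  using integrable_sinc_pos_powr[OF assms]
  by (rule integral_even_lobes) (simp_all add: sinc_pos_minus sinc_pos_eq_0)

lemma sinc_square_lobe_sums:
  "(\<lambda>k. LBINT u:{2 * real k + 2..2 * real k + 3}. sinc_square u) sums
      ((LINT u|lborel. sinc_pos u powr 2) / 2 - (LBINT u:{0..1}. sinc_square u))"
proof -
  have "(LBINT u:{2 * real k + 2..2 * real k + 3}. sinc_pos u powr 2) = (LBINT u:{2 * real k + 2..2 * real k + 3}. sinc_square u)" for k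
    using sinc_pos_squared_eq[of "Suc k"] by (intro set_lebesgue_integral_cong) auto
  moreover have "(LBINT u:{0..1}. sinc_pos u powr 2) = (LBINT u:{0..1}. sinc_square u)"
    using sinc_pos_squared_eq[of 0] by (intro set_lebesgue_integral_cong) auto
  ultimately show ?thesis
    using sinc_pos_lobe_sums[of 2] by simp
qed

lemma set_integrable_sinc_pos: "set_integrable lborel {0..1} sinc_pos"
  unfolding set_integrable_def
proof (rule Bochner_Integration.integrable_bound)
  show "integrable lborel (indicat_real {0..1::real})"
    by (rule integrable_real_indicator) auto
  show "AE u in lborel. norm (indicat_real {0..1} u *\<^sub>R sinc_pos u) \<le> norm (indicat_real {0..1} u)"
    using sinc_pos_nonneg sinc_pos_le_1 by (auto split: split_indicator)
qed simp

lemma sinc_pos_main_lobe_five_thirds_le: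
  "(LBINT u:{0..1}. sinc_pos u powr (5/3)) \<le> 27/100 * (59/100) + 20/27 * (LBINT u:{0..1}. sinc_square u)"
proof -
  have int2: "set_integrable lborel {0..1} (\<lambda>u. sinc_pos u powr 2)"
    unfolding set_integrable_def by (intro integrable_mult_indicator integrable_sinc_pos_powr) auto
  have "(LBINT u:{0..1}. sinc_pos u powr (5/3)) \<le> (LBINT u:{0..1}. 27/100 * sinc_pos u + 20/27 * sinc_pos u powr 2)"
    unfolding set_lebesgue_integral_def
  proof (rule integral_mono')
    have "set_integrable lborel {0..1} (\<lambda>u. 27/100 * sinc_pos u + 20/27 * sinc_pos u powr 2)"
      using set_integrable_sinc_pos int2 by (intro set_integral_add set_integrable_mult_right) auto
    then show "integrable lborel (\<lambda>u. indicat_real {0..1} u *\<^sub>R (27/100 * sinc_pos u + 20/27 * sinc_pos u powr 2))"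
      by (simp add: set_integrable_def)
    show "indicat_real {0..1} u *\<^sub>R sinc_pos u powr (5/3) \<le> indicat_real {0..1} u *\<^sub>R (27/100 * sinc_pos u + 20/27 * sinc_pos u powr 2)" for u
      using powr_five_thirds_le[OF sinc_pos_nonneg[of u]] sinc_pos_nonneg[of u]
      by (auto split: split_indicator)
    show "0 \<le> indicat_real {0..1} u *\<^sub>R (27/100 * sinc_pos u + 20/27 * sinc_pos u powr 2)" for u
      using sinc_pos_nonneg[of u] by (auto split: split_indicator)
  qed
  also have "\<dots> = 27/100 * (LBINT u:{0..1}. sinc_pos u) + 20/27 * (LBINT u:{0..1}. sinc_pos u powr 2)"
    using set_integrable_sinc_pos int2 by (subst set_integral_add) (auto intro: set_integrable_mult_right)
  also have "(LBINT u:{0..1}. sinc_pos u powr 2) = (LBINT u:{0..1}. sinc_square u)"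
    using sinc_pos_squared_eq[of 0] by (intro set_lebesgue_integral_cong) auto
  finally show ?thesis
    using sinc_pos_main_lobe_integral_le by linarith
qed

text \<open>
  Lyapunov's inequality: the logarithm of the integral is convex in the exponent. Both powers are normalised to have
  integral 1 before the weighted inequality between the means is integrated, which covers the end points \<open>\<theta> = 0\<close> and
  \<open>\<theta> = 1\<close> as well.
\<close>
lemma integral_powr_interpolation:
  fixes f :: "'a \<Rightarrow> real"
  assumes "0 \<le> \<theta>" "\<theta> \<le> 1" and nn: "\<And>x. 0 \<le> f x"
    and a: "integrable M (\<lambda>x. f x powr a)" and b: "integrable M (\<lambda>x. f x powr b)"
    and pos: "0 < (LINT x|M. f x powr a)" "0 < (LINT x|M. f x powr b)"
  shows "(LINT x|M. f x powr ((1 - \<theta>) * a + \<theta> * b)) \<le> (LINT x|M. f x powr a) powr (1 - \<theta>) * (LINT x|M. f x powr b) powr \<theta>"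
proof -
  define A where "A = (LINT x|M. f x powr a)"
  define B where "B = (LINT x|M. f x powr b)"
  have "A > 0" "B > 0" using pos by (auto simp: A_def B_def)
  have young: "f x powr ((1 - \<theta>) * a + \<theta> * b) \<le> A powr (1 - \<theta>) * B powr \<theta> * ((1 - \<theta>) * (f x powr a / A) + \<theta> * (f x powr b / B))" for x
  proof (cases "f x = 0")
    case True
    then show ?thesis by simp
  next
    case False
    then have "f x > 0" using nn[of x] by simp
    have "(f x powr a / A) powr (1 - \<theta>) * (f x powr b / B) powr \<theta> \<le> (1 - \<theta>) * (f x powr a / A) + \<theta> * (f x powr b / B)"
      using \<open>f x > 0\<close> \<open>A > 0\<close> \<open>B > 0\<close> assms by (intro Youngs_inequality_0) auto
    then have "A powr (1 - \<theta>) * B powr \<theta> * ((f x powr a / A) powr (1 - \<theta>) * (f x powr b / B) powr \<theta>)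
       \<le> A powr (1 - \<theta>) * B powr \<theta> * ((1 - \<theta>) * (f x powr a / A) + \<theta> * (f x powr b / B))"
      by (intro mult_left_mono) auto
    also have "A powr (1 - \<theta>) * B powr \<theta> * ((f x powr a / A) powr (1 - \<theta>) * (f x powr b / B) powr \<theta>)
       = f x powr (a * (1 - \<theta>)) * f x powr (b * \<theta>)"
      using \<open>A > 0\<close> \<open>B > 0\<close> by (simp add: powr_divide powr_powr)
    also have "\<dots> = f x powr ((1 - \<theta>) * a + \<theta> * b)"
      by (simp add: powr_add mult.commute)
    finally show ?thesis .
  qed
  have "(LINT x|M. f x powr ((1 - \<theta>) * a + \<theta> * b)) \<le>
    (LINT x|M. A powr (1 - \<theta>) * B powr \<theta> * ((1 - \<theta>) * (f x powr a / A) + \<theta> * (f x powr b / B)))"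
  proof (rule integral_mono')
    show "integrable M (\<lambda>x. A powr (1 - \<theta>) * B powr \<theta> * ((1 - \<theta>) * (f x powr a / A) + \<theta> * (f x powr b / B)))"
      using a b by auto
    show "0 \<le> A powr (1 - \<theta>) * B powr \<theta> * ((1 - \<theta>) * (f x powr a / A) + \<theta> * (f x powr b / B))" for x
      using order_trans[OF powr_ge_zero young] .
  qed (rule young)
  also have "\<dots> = A powr (1 - \<theta>) * B powr \<theta> * ((1 - \<theta>) * (A / A) + \<theta> * (B / B))"
    using a b by (simp add: A_def B_def)
  also have "\<dots> = A powr (1 - \<theta>) * B powr \<theta>"
    using \<open>A > 0\<close> \<open>B > 0\<close> by simp
  finally show ?thesis by (simp add: A_def B_def)
qed

text \<open>
  The left side is estimated through \<open>J\<close> itself, so that the claim becomes a quadratic inequality in \<open>J\<close> on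
  \<open>{0.45..0.59}\<close>.
\<close>
lemma sinc_pos_five_thirds_bound:
  defines "J \<equiv> LBINT u:{0..1}. sinc_square u" and "N \<equiv> LINT u|lborel. sinc_pos u powr (5/3)"
  shows "4 * N powr (3/2) \<le> 10 * J"
proof -
  have "J \<ge> 45/100"
    unfolding J_def by (rule sinc_square_main_lobe_integral_ge)
  have "J \<le> 59/100"
  proof -
    have "J = (LBINT u:{0..1}. sinc_pos u powr 2)"
      unfolding J_def using sinc_pos_squared_eq[of 0] by (intro set_lebesgue_integral_cong) auto
    also have "\<dots> \<le> (LBINT u:{0..1}. sinc_pos u)"
      unfolding set_lebesgue_integral_def
    proof (rule integral_mono')
      show "integrable lborel (\<lambda>u. indicat_real {0..1} u *\<^sub>R sinc_pos u)"
        using set_integrable_sinc_pos by (simp add: set_integrable_def)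
      show "indicat_real {0..1} u *\<^sub>R sinc_pos u powr 2 \<le> indicat_real {0..1} u *\<^sub>R sinc_pos u" for u
        using mult_left_mono[OF sinc_pos_le_1 sinc_pos_nonneg, of u u] sinc_pos_nonneg[of u]
        by (auto simp: powr_numeral power2_eq_square split: split_indicator)
      show "0 \<le> indicat_real {0..1} u *\<^sub>R sinc_pos u" for u
        by (simp add: sinc_pos_nonneg)
    qed
    also have "\<dots> \<le> 59/100" by (rule sinc_pos_main_lobe_integral_le)
    finally show ?thesis .
  qed
  have "N / 2 - (LBINT u:{0..1}. sinc_pos u powr (5/3)) \<le> 93/2000"
    unfolding N_def by (rule sinc_pos_tail_sum_le[OF sinc_pos_lobe_sums]) simp
  then have N: "N \<le> 2 * (27/100 * (59/100) + 20/27 * J + 93/2000)"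
    using sinc_pos_main_lobe_five_thirds_le by (simp add: J_def)
  define V where "V = 2 * (27/100 * (59/100) + 20/27 * J + 93/2000)"
  have "V > 0" using \<open>J \<ge> 45/100\<close> by (simp add: V_def)
  have "N \<ge> 0" by (simp add: N_def)
  have "N powr (3/2) \<le> V powr (3/2)"
    using N \<open>N \<ge> 0\<close> by (intro powr_mono2) (auto simp: V_def)
  also have "V powr (3/2) = V * sqrt V"
    using \<open>V > 0\<close> by (simp add: powr_add[of V 1 "1/2", simplified] powr_half_sqrt)
  also have "\<dots> \<le> V * ((V + 10816/10000) / (2 * (104/100)))"
  proof (intro mult_left_mono)
    \<comment> \<open>Tangent to the square root at \<open>1.04\<^sup>2\<close>, close to the actual value of \<open>V\<close>.\<close>
    have "0 \<le> (sqrt V - 104/100)\<^sup>2" by simp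
    then show "sqrt V \<le> (V + 10816/10000) / (2 * (104/100))"
      using \<open>V > 0\<close> by (simp add: power2_diff field_simps)
  qed (use \<open>V > 0\<close> in simp)
  finally have "4 * N powr (3/2) \<le> 4 * (V * ((V + 10816/10000) / (2 * (104/100))))"
    by linarith
  also have "\<dots> \<le> 10 * J"
  proof -
    have "0 \<le> (J - 45/100) * (59/100 - J)"
      using \<open>J \<ge> 45/100\<close> \<open>J \<le> 59/100\<close> by (intro mult_nonneg_nonneg) auto
    then have "J * J \<le> 104/100 * J - 2655/10000"
      by (simp add: field_simps)
    moreover have "4 * (V * ((V + 10816/10000) / (2 * (104/100)))) = 3841257/3250000 + 9524/1755 * J + 40000/9477 * (J * J)"
      by (simp add: V_def algebra_simps)
    ultimately show ?thesis
      using \<open>J \<ge> 45/100\<close> by linarith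
  qed
  finally show ?thesis .
qed

text \<open>
  With \<open>\<theta> = 3 - 3 / r\<close> the exponent \<open>1 + 1 / r\<close> is \<open>(1 - \<theta>) * 2 + \<theta> * 5/3\<close>. Interpolation gives the geometric mean of
  \<open>N 2\<close> and \<open>N (5/3) powr (3/2)\<close> with weights \<open>3 - 2 * r\<close> and \<open>2 * r - 2\<close>; the arithmetic mean is affine in \<open>r\<close>.
\<close>
lemma sinc_pos_norm_power_le:
  fixes r :: real
  defines "J \<equiv> LBINT u:{0..1}. sinc_square u"
    and "N \<equiv> \<lambda>q. LINT u|lborel. sinc_pos u powr q"
  assumes r: "1 \<le> r" "r \<le> 3/2"
  shows "N (1 + 1 / r) powr r \<le> (3 - 2 * r) * N 2 + (5 * r - 5) * J"
proof -
  have "J \<ge> 45/100"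
    unfolding J_def by (rule sinc_square_main_lobe_integral_ge)
  have "0 \<le> N 2 / 2 - J"
    unfolding N_def J_def
    by (rule sums_le[OF _ sums_zero sinc_square_lobe_sums])
       (auto simp: set_lebesgue_integral_def sinc_square_def intro!: integral_nonneg_AE)
  then have "N 2 > 0" using \<open>J \<ge> 45/100\<close> by simp
  have "N 2 \<le> N (5/3)"
    unfolding N_def
  proof (rule integral_mono')
    show "sinc_pos u powr 2 \<le> sinc_pos u powr (5/3)" for u
      using sinc_pos_nonneg[of u] sinc_pos_le_1[of u] by (intro powr_mono') auto
  qed (auto intro: integrable_sinc_pos_powr)
  then have "N (5/3) > 0" using \<open>N 2 > 0\<close> by simp
  define \<theta> where "\<theta> = 3 - 3 / r"
  have \<theta>: "0 \<le> \<theta>" "\<theta> \<le> 1"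
    using r by (auto simp: \<theta>_def field_simps)
  have "1 + 1 / r = (1 - \<theta>) * 2 + \<theta> * (5/3)"
    using r by (simp add: \<theta>_def field_simps)
  then have "N (1 + 1 / r) \<le> N 2 powr (1 - \<theta>) * N (5/3) powr \<theta>"
    using integral_powr_interpolation[OF \<theta>, of sinc_pos lborel 2 "5/3"] \<open>N 2 > 0\<close> \<open>N (5/3) > 0\<close>
      integrable_sinc_pos_powr[of 2] integrable_sinc_pos_powr[of "5/3"]
    unfolding N_def by (simp only: sinc_pos_nonneg)
  then have "N (1 + 1 / r) powr r \<le> (N 2 powr (1 - \<theta>) * N (5/3) powr \<theta>) powr r"
    using r by (intro powr_mono2) (auto simp: N_def)
  also have "\<dots> = N 2 powr ((1 - \<theta>) * r) * N (5/3) powr (\<theta> * r)"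
    by (simp only: powr_mult powr_powr)
  also have "(1 - \<theta>) * r = 3 - 2 * r"
    using r by (simp add: \<theta>_def field_simps)
  also have "\<theta> * r = 3/2 * (2 * r - 2)"
    using r by (simp add: \<theta>_def field_simps)
  also have "N 2 powr (3 - 2 * r) * N (5/3) powr (3/2 * (2 * r - 2)) = N 2 powr (3 - 2 * r) * (N (5/3) powr (3/2)) powr (2 * r - 2)"
    by (simp only: powr_powr)
  also have "\<dots> \<le> (3 - 2 * r) * N 2 + (2 * r - 2) * N (5/3) powr (3/2)"
    using r \<open>N 2 > 0\<close> \<open>N (5/3) > 0\<close> by (intro Youngs_inequality_0) auto
  also have "\<dots> \<le> (3 - 2 * r) * N 2 + (2 * r - 2) * (5/2 * J)"
    using r sinc_pos_five_thirds_bound by (intro add_left_mono mult_left_mono) (auto simp: N_def J_def)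
  also have "\<dots> = (3 - 2 * r) * N 2 + (5 * r - 5) * J"
    by (simp add: field_simps)
  finally show ?thesis .
qed

theorem corollary1p5:
  fixes p :: real
  assumes "4 \<le> p" and "p \<le> 5"
  shows "PW_const p \<le> ereal
    (2 * (LBINT x:{0..2/p}. (sin (p/2 * pi * x))\<^sup>2 / (pi\<^sup>2 * x\<^sup>2))
     + 2 * (\<Sum>n::nat. LBINT x:{real n + 4/p..real n + 1/2 + 3/p}.
             (sin (p/2 * pi * (x - real n)))\<^sup>2 / (pi\<^sup>2 * x\<^sup>2))
     + 2 * (\<Sum>n::nat. LBINT x:{real n + 1/2 + 3/p..real n + 1 + 2/p}.
             (sin (p/2 * pi * (x - real n - 1)))\<^sup>2 / (pi\<^sup>2 * x\<^sup>2)))"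
proof -
  define J where "J = (LBINT u:{0..1}. sinc_square u)"
  define N where "N = (\<lambda>q. LINT u|lborel. sinc_pos u powr q)"
  define T where "T = N 2 / 2 - J"
  define r where "r = (p - 2) / 2"
  have r: "1 \<le> r" "r \<le> 3/2" using assms by (auto simp: r_def)
  have T: "(\<lambda>n. LBINT u:{2 * real n + 2..2 * real n + 3}. sinc_square u) sums T"
    unfolding T_def N_def J_def by (rule sinc_square_lobe_sums)
  have "0 \<le> T"
    by (rule sums_le[OF _ sums_zero T])
       (auto simp: set_lebesgue_integral_def sinc_square_def intro!: integral_nonneg_AE)
  have "p / (p - 2) = 1 + 1 / r"
    using assms by (simp add: r_def field_simps)
  then have "PW_const p \<le> ereal (2 * N (1 + 1 / r) powr r)"
    using PW_const_le[of p] assms by (simp add: N_def r_def)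
  also have "2 * N (1 + 1 / r) powr r \<le> 2 * ((3 - 2 * r) * N 2 + (5 * r - 5) * J)"
    using sinc_pos_norm_power_le[OF r] by (simp add: N_def J_def)
  also have "\<dots> = p * J + 4 * (5 - p) * T"
    by (simp add: T_def r_def field_simps)
  also have "\<dots> \<le> p * J + 16 / p * T"
  proof -
    have "4 * (5 - p) * p \<le> 16"
      using mult_nonneg_nonneg[of "p - 4" "p - 1"] assms by (simp add: algebra_simps)
    then have "4 * (5 - p) \<le> 16 / p"
      using assms by (simp add: pos_le_divide_eq)
    then show ?thesis
      using mult_right_mono[OF _ \<open>0 \<le> T\<close>] by (intro add_left_mono) blast
  qed
  also have "\<dots> \<le> 2 * (LBINT x:{0..2/p}. (sin (p/2 * pi * x))\<^sup>2 / (pi\<^sup>2 * x\<^sup>2))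
     + 2 * (\<Sum>n::nat. LBINT x:{real n + 4/p..real n + 1/2 + 3/p}.
             (sin (p/2 * pi * (x - real n)))\<^sup>2 / (pi\<^sup>2 * x\<^sup>2))
     + 2 * (\<Sum>n::nat. LBINT x:{real n + 1/2 + 3/p..real n + 1 + 2/p}.
             (sin (p/2 * pi * (x - real n - 1)))\<^sup>2 / (pi\<^sup>2 * x\<^sup>2))"
    unfolding J_def by (rule sine_lobe_series_ge[OF assms T])
  finally show ?thesis by simp
qed

end
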